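(* Let $q$ be a prime power and $k$ a positive integer, and let $M$ be a $GF(q)$-representable matroid with (matroid) tree-width at most $k$. Then the characteristic polynomial $\chi_M(\lambda)$ is identically zero or else $\chi_M(\lambda)>0$ for all real $\lambda>q^{k-1}$.
   Context: For a loopless matroid $M$ with ground set $E$ and rank function $r$, the characteristic polynomial is $\chi_M(\lambda)=\sum_{F\in L}\mu_M(\emptyset,F)\lambda^{r(E)-r(F)}$, where $L$ is the lattice of flats of $M$ and $\mu_M$ its Möbius function; if $M$ has a loop, $\chi_M(\lambda)$ is defined to be $0$. Matroid tree-width: a tree-decomposition of $M$ is a pair $(T,\tau)$ with $T$ a tree and $\tau:E(M)\to V(T)$ an arbitrary map. For a vertex $v$ of $T$, let $T_1,\dots,T_c$ be the components of $T-v$ and $B_j=\{e\in E(M):\tau(e)\in V(T_j)\}$. The rank defect of a set $B$ is $\mathrm{rd}(B)=r(M)-r(E(M)-B)$. The node width of $v$ is $r(M)-\sum_{j=1}^{c}\mathrm{rd}(B_j)$ (equal to $r(M)$ if $T$ has one vertex). The width of $(T,\tau)$ is the maximum node width over the vertices of $T$, and the tree-width $\mathrm{tw}(M)$ is the minimum width over all tree-decompositions of $M$. *)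

theory Defs
  imports Complex_Main "HOL-Library.Cardinality"
    "HOL-Computational_Algebra.Polynomial"
    "HOL-Number_Theory.Prime_Powers"
begin

section \<open>Matroids\<close>

record 'a pre_matroid =
  ground :: "'a set"
  indeps :: "'a set set"

locale matroid =
  fixes M :: "'a pre_matroid"
  assumes finite_ground: "finite (ground M)"
    and indeps_subset: "X \<in> indeps M \<Longrightarrow> X \<subseteq> ground M"
    and empty_indep: "{} \<in> indeps M"
    and indeps_down: "X \<in> indeps M \<Longrightarrow> Y \<subseteq> X \<Longrightarrow> Y \<in> indeps M"
    and augment: "X \<in> indeps M \<Longrightarrow> Y \<in> indeps M \<Longrightarrow> card X < card Y \<Longrightarrow>
      \<exists>e \<in> Y - X. insert e X \<in> indeps M"

definition rk :: "'a pre_matroid \<Rightarrow> 'a set \<Rightarrow> nat" where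
  "rk M X = Max (card ` {Y \<in> indeps M. Y \<subseteq> X})"

definition loopless :: "'a pre_matroid \<Rightarrow> bool" where
  "loopless M \<longleftrightarrow> (\<forall>e \<in> ground M. {e} \<in> indeps M)"

definition flats :: "'a pre_matroid \<Rightarrow> 'a set set" where
  "flats M = {F. F \<subseteq> ground M \<and> (\<forall>e \<in> ground M - F. rk M F < rk M (insert e F))}"

text \<open>
  Moebius function of a family \<open>L\<close> of finite sets ordered by inclusion. The guard
  \<open>finite Y\<close> is only there to make the recursion terminate.
\<close>

function moebius :: "'a set set \<Rightarrow> 'a set \<Rightarrow> 'a set \<Rightarrow> int" where
  "moebius L X Y =
    (if X = Y then 1
     else if X \<subset> Y \<and> finite Y then - (\<Sum>Z \<in> {Z \<in> L. X \<subseteq> Z \<and> Z \<subset> Y}. moebius L X Z)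
     else 0)"
  by pat_completeness auto
termination
  by (relation "measure (\<lambda>(L, X, Y). card Y)") (auto intro: psubset_card_mono)

declare moebius.simps [simp del]

definition characteristic_poly :: "'a pre_matroid \<Rightarrow> real poly" where
  "characteristic_poly M =
    (if loopless M
     then \<Sum>F \<in> flats M. monom (of_int (moebius (flats M) {} F)) (rk M (ground M) - rk M F)
     else 0)"

text \<open>
  A representation is a matrix \<open>A\<close> with \<open>n\<close> rows and with columns indexed by the ground set.
  Independence is that of the indexed family of columns, so that equal
  columns with different indices are dependent.
\<close>

definition columns_independent :: "nat \<Rightarrow> (nat \<Rightarrow> 'a \<Rightarrow> 'f::field) \<Rightarrow> 'a set \<Rightarrow> bool" where
  "columns_independent n A X \<longleftrightarrow>
    (\<forall>c. (\<forall>i<n. (\<Sum>e \<in> X. c e * A i e) = 0) \<longrightarrow> (\<forall>e \<in> X. c e = 0))"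

definition representable :: "'f::field itself \<Rightarrow> 'a pre_matroid \<Rightarrow> bool" where
  "representable (_ :: 'f itself) M \<longleftrightarrow>
    (\<exists>n (A :: nat \<Rightarrow> 'a \<Rightarrow> 'f). \<forall>X \<subseteq> ground M. X \<in> indeps M \<longleftrightarrow> columns_independent n A X)"


section \<open>Finite trees\<close>

text \<open>
  A simple graph has a vertex set \<open>V\<close> and a set \<open>D\<close> of two-element subsets of \<open>V\<close> as edges.
  The predicate \<open>tree\<close> in the AFP entry \<open>Graph_Theory\<close> is not
  suitable, as it only excludes directed cycles.
\<close>

definition adjacent :: "'v set set \<Rightarrow> ('v \<times> 'v) set" where
  "adjacent D = {(u, v). {u, v} \<in> D}"

definition reachable_in :: "'v set \<Rightarrow> 'v set set \<Rightarrow> ('v \<times> 'v) set" where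
  "reachable_in V D = {(u, v). u \<in> V \<and> v \<in> V \<and> (u, v) \<in> (adjacent D \<inter> V \<times> V)\<^sup>*}"

definition components :: "'v set \<Rightarrow> 'v set set \<Rightarrow> 'v set set" where
  "components V D = V // reachable_in V D"

definition is_cycle :: "'v set set \<Rightarrow> 'v list \<Rightarrow> bool" where
  "is_cycle D p \<longleftrightarrow> 3 \<le> length p \<and> distinct p \<and>
    (\<forall>i < length p. {p ! i, p ! (Suc i mod length p)} \<in> D)"

definition is_tree :: "'v set \<Rightarrow> 'v set set \<Rightarrow> bool" where
  "is_tree V D \<longleftrightarrow> finite V \<and> V \<noteq> {} \<and> (\<forall>d \<in> D. d \<subseteq> V \<and> card d = 2) \<and>
    (\<forall>u \<in> V. \<forall>v \<in> V. (u, v) \<in> reachable_in V D) \<and> (\<nexists>p. is_cycle D p)"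


section \<open>Tree-width of matroids\<close>

text \<open>
  Every finite tree is isomorphic to one whose vertices are natural numbers, so only
  such trees are used in decompositions.
\<close>

definition tree_decomposition ::
    "'a pre_matroid \<Rightarrow> nat set \<Rightarrow> nat set set \<Rightarrow> ('a \<Rightarrow> nat) \<Rightarrow> bool" where
  "tree_decomposition M V D \<tau> \<longleftrightarrow> is_tree V D \<and> \<tau> ` ground M \<subseteq> V"

definition rank_defect :: "'a pre_matroid \<Rightarrow> 'a set \<Rightarrow> int" where
  "rank_defect M B = int (rk M (ground M)) - int (rk M (ground M - B))"

text \<open>
  In \<open>components (V - {v}) D\<close> the edges at \<open>v\<close> are irrelevant, so these are the vertex sets of
  the components of the tree with \<open>v\<close> deleted.
\<close>

definition node_width ::
    "'a pre_matroid \<Rightarrow> nat set \<Rightarrow> nat set set \<Rightarrow> ('a \<Rightarrow> nat) \<Rightarrow> nat \<Rightarrow> int" where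
  "node_width M V D \<tau> v = int (rk M (ground M)) -
    (\<Sum>C \<in> components (V - {v}) D. rank_defect M {e \<in> ground M. \<tau> e \<in> C})"

definition width :: "'a pre_matroid \<Rightarrow> nat set \<Rightarrow> nat set set \<Rightarrow> ('a \<Rightarrow> nat) \<Rightarrow> int" where
  "width M V D \<tau> = Max (node_width M V D \<tau> ` V)"

text \<open>
  The least element exists because node widths in a matroid are nonnegative, the rank
  defect being superadditive on disjoint sets.
\<close>

definition tree_width :: "'a pre_matroid \<Rightarrow> int" where
  "tree_width M = (LEAST w. \<exists>V D \<tau>. tree_decomposition M V D \<tau> \<and> w = width M V D \<tau>)"

end

theory Submission
  imports Defs
begin

text \<open>
  Write the elements of \<open>M\<close> as vectors spanning a space \<open>S\<close>. By inclusion-exclusion, \<open>\<chi>\<^sub>M(|Y|)\<close> is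
  the number of linear maps \<open>S \<rightarrow> Y\<close> killing no element of \<open>M\<close>, for every finite vector space \<open>Y\<close>.

  A node \<open>v\<close> of a tree-decomposition has a bag, the intersection of \<open>span (E - B\<^sub>j)\<close> over the branches
  at \<open>v\<close>, whose dimension is the node width. Adding the nodes one by one along edges of the tree, the
  bag of the new node meets the span of the earlier bags inside the bag of its neighbour. Hence the
  union \<open>N\<close> of the bags is built like a chordal graph, by repeatedly joining a new vector to a subspace
  \<open>I\<close> contained in the set obtained so far, with \<open>|I| \<le> q\<^bsup>k-1\<^esup>\<close>.

  Sort the linear maps \<open>S \<rightarrow> Y\<close> by their zero set \<open>K\<close> in \<open>N\<close>. As \<open>K \<inter> I\<close> determines the size of the image
  of \<open>I\<close>, every step of the construction multiplies the number of maps with zero set \<open>K\<close> by \<open>0\<close>, by \<open>1\<close>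
  or by \<open>|Y| - |I| / |K \<inter> I|\<close>. So \<open>\<chi>\<^sub>M\<close> is a sum of products of factors \<open>\<lambda> - a\<close> with \<open>a \<le> q\<^bsup>k-1\<^esup>\<close>.
\<close>

section \<open>Subspaces over a finite field\<close>

lemma card_eq_card_image_times_fibre:
  assumes "finite A" and "\<And>y. y \<in> f ` A \<Longrightarrow> card {x \<in> A. f x = y} = c"
  shows "card A = card (f ` A) * c"
proof -
  have "card A = (\<Sum>x\<in>A. 1)"
    by simp
  also have "\<dots> = (\<Sum>y\<in>f ` A. \<Sum>x\<in>{x \<in> A. f x = y}. 1)"
    by (rule sum.group[symmetric]) (use assms in auto)
  also have "\<dots> = card (f ` A) * c"
    using assms(2) by simp
  finally show ?thesis .
qed

text \<open>Only the scalars are assumed finite. The dimension \<open>d\<close> of a finite subspace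
  enters through its size \<open>CARD('f) ^ d\<close>, so that facts on dimensions become equations
  between cardinalities.\<close>

locale finite_field_space = vector_space scale
  for scale :: "'f::{finite,field} \<Rightarrow> 'v::ab_group_add \<Rightarrow> 'v" (infixr \<open>*s\<close> 75)
begin

lemma mem_span_insert_subspace:
  "subspace S \<Longrightarrow> v \<in> span (insert x S) \<longleftrightarrow> (\<exists>c. v - c *s x \<in> S)"
  by (metis span_breakdown_eq span_eq_iff)

lemma coefficient_unique:
  assumes "subspace S" "x \<notin> S" "v - c *s x \<in> S" "v - d *s x \<in> S"
  shows "c = d"
proof (rule ccontr)
  assume "c \<noteq> d"
  have "(v - d *s x) - (v - c *s x) \<in> S"
    using assms subspace_diff by blast
  then have "(c - d) *s x \<in> S"
    by (simp add: scale_left_diff_distrib)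
  then have "inverse (c - d) *s (c - d) *s x \<in> S"
    using assms(1) subspace_scale by blast
  then show False
    using \<open>c \<noteq> d\<close> assms(2) by simp
qed

lemma span_insert_bij:
  assumes "subspace S" "x \<notin> S"
  shows "bij_betw (\<lambda>(s, c). s + c *s x) (S \<times> UNIV) (span (insert x S))"
proof (rule bij_betw_imageI)
  show "inj_on (\<lambda>(s, c). s + c *s x) (S \<times> UNIV)"
  proof (rule inj_onI, clarify)
    fix s c t d assume *: "s \<in> S" "t \<in> S" "s + c *s x = t + d *s x"
    then have "c = d"
      using coefficient_unique[OF assms, of "s + c *s x" c d] by (metis add_diff_cancel_right')
    with * show "s = t \<and> c = d"
      by simp
  qed
  show "(\<lambda>(s, c). s + c *s x) ` (S \<times> UNIV) = span (insert x S)"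
  proof (intro equalityI subsetI)
    fix v assume "v \<in> span (insert x S)"
    then obtain c where "v - c *s x \<in> S"
      using assms(1) mem_span_insert_subspace by blast
    then have "(v - c *s x, c) \<in> S \<times> UNIV"
      by simp
    then show "v \<in> (\<lambda>(s, c). s + c *s x) ` (S \<times> UNIV)"
      by (rule rev_image_eqI) simp
  qed (auto simp: span_base span_scale span_add)
qed

lemma finite_span_insert:
  assumes "subspace S" "finite S"
  shows "finite (span (insert x S))"
proof (cases "x \<in> S")
  case True
  with assms show ?thesis
    by (simp add: insert_absorb span_eq_iff[THEN iffD2])
next
  case False
  with span_insert_bij[OF assms(1)] assms(2) show ?thesis
    by (metis bij_betw_finite finite_SigmaI finite)
qed

lemma card_span_insert:
  assumes "subspace S" "x \<notin> S"
  shows "card (span (insert x S)) = CARD('f) * card S"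
  using bij_betw_same_card[OF span_insert_bij[OF assms]] by (simp add: card_cartesian_product mult.commute)

lemma span_insert_span: "span (insert x (span B)) = span (insert x B)"
  by (intro equalityI span_minimal)
    (auto intro: span_base span_mono[THEN subsetD, OF subset_insertI])

lemma finite_span: "finite B \<Longrightarrow> finite (span B)"
  by (induction B rule: finite_induct)
    (simp, metis finite_span_insert span_insert_span subspace_span)

lemma card_subspace_pos: "subspace S \<Longrightarrow> finite S \<Longrightarrow> card S > 0"
  using card_gt_0_iff subspace_0 by blast

lemma one_less_card_field: "1 < CARD('f)"
proof -
  have "card {0, 1 :: 'f} \<le> CARD('f)"
    by (rule card_mono) auto
  then show ?thesis
    by simp
qed

text \<open>Addition maps \<open>U \<times> T\<close> onto the sum of the two spaces, and the fibre
  through \<open>(u, t)\<close> consists of the pairs \<open>(u + w, t - w)\<close> with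
  \<open>w \<in> U \<inter> T\<close>. This is the dimension formula in multiplicative form.\<close>

lemma card_Int_times_card_span_Un:
  assumes "subspace U" "finite U" "subspace T" "finite T"
  shows "card (U \<inter> T) * card (span (U \<union> T)) = card U * card T"
proof -
  let ?f = "\<lambda>(u, t). u + t"
  have "card (U \<times> T) = card (?f ` (U \<times> T)) * card (U \<inter> T)"
  proof (rule card_eq_card_image_times_fibre)
    show "finite (U \<times> T)"
      using assms by simp
    fix y assume "y \<in> ?f ` (U \<times> T)"
    then obtain u t where ut: "u \<in> U" "t \<in> T" "y = u + t"
      by auto
    have "bij_betw (\<lambda>w. (u + w, t - w)) (U \<inter> T) {z \<in> U \<times> T. ?f z = y}"
    proof (rule bij_betw_imageI)
      show "inj_on (\<lambda>w. (u + w, t - w)) (U \<inter> T)"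
        by (auto simp: inj_on_def)
      have "z \<in> (\<lambda>w. (u + w, t - w)) ` (U \<inter> T)" if zin: "z \<in> U \<times> T" and zy: "?f z = y" for z
      proof -
        obtain a b where z: "z = (a, b)" "a \<in> U" "b \<in> T"
          using zin by auto
        with zy ut have eq: "a - u = t - b"
          by (simp add: algebra_simps)
        then have "a - u \<in> U \<inter> T"
          using z ut assms by (metis IntI subspace_diff)
        moreover have "t - (a - u) = b"
          unfolding eq by simp
        then have "z = (u + (a - u), t - (a - u))"
          using z(1) by simp
        ultimately show ?thesis
          by (rule rev_image_eqI)
      qed
      then show "(\<lambda>w. (u + w, t - w)) ` (U \<inter> T) = {z \<in> U \<times> T. ?f z = y}"
        using ut assms by (auto simp: subspace_add subspace_diff)
    qed
    then show "card {z \<in> U \<times> T. ?f z = y} = card (U \<inter> T)"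
      by (rule bij_betw_same_card[symmetric])
  qed
  moreover have "?f ` (U \<times> T) = span (U \<union> T)"
    using assms by (auto simp: span_Un span_eq_iff[THEN iffD2] image_iff)
  ultimately show ?thesis
    by (simp add: card_cartesian_product mult.commute)
qed

section \<open>Counting linear maps\<close>

text \<open>The maps vanish outside \<open>S\<close>, so that distinct elements differ on \<open>S\<close>.\<close>

definition linear_maps :: "'v set \<Rightarrow> 'v set \<Rightarrow> ('v \<Rightarrow> 'v) set" where
  "linear_maps S Y = {\<phi>. (\<forall>u\<in>S. \<forall>v\<in>S. \<phi> (u + v) = \<phi> u + \<phi> v) \<and>
    (\<forall>c. \<forall>v\<in>S. \<phi> (c *s v) = c *s \<phi> v) \<and> \<phi> ` S \<subseteq> Y \<and> (\<forall>v. v \<notin> S \<longrightarrow> \<phi> v = 0)}"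

lemma linear_maps_add:
  "\<phi> \<in> linear_maps S Y \<Longrightarrow> u \<in> S \<Longrightarrow> v \<in> S \<Longrightarrow> \<phi> (u + v) = \<phi> u + \<phi> v"
  by (simp add: linear_maps_def)

lemma linear_maps_scale:
  "\<phi> \<in> linear_maps S Y \<Longrightarrow> v \<in> S \<Longrightarrow> \<phi> (c *s v) = c *s \<phi> v"
  by (simp add: linear_maps_def)

lemma linear_maps_mem: "\<phi> \<in> linear_maps S Y \<Longrightarrow> v \<in> S \<Longrightarrow> \<phi> v \<in> Y"
  by (auto simp: linear_maps_def)

lemma linear_maps_outside: "\<phi> \<in> linear_maps S Y \<Longrightarrow> v \<notin> S \<Longrightarrow> \<phi> v = 0"
  by (simp add: linear_maps_def)

lemma linear_maps_diff:
  assumes "\<phi> \<in> linear_maps S Y" "subspace S" "u \<in> S" "v \<in> S"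
  shows "\<phi> (u - v) = \<phi> u - \<phi> v"
proof -
  have "\<phi> ((u - v) + v) = \<phi> (u - v) + \<phi> v"
    using assms by (intro linear_maps_add) (auto intro: subspace_diff)
  then show ?thesis
    by simp
qed

lemma linear_maps_zero: "\<phi> \<in> linear_maps S Y \<Longrightarrow> subspace S \<Longrightarrow> \<phi> 0 = 0"
  using linear_maps_diff[of \<phi> S Y 0 0] subspace_0 by simp

definition restrict_map :: "'v set \<Rightarrow> ('v \<Rightarrow> 'v) \<Rightarrow> 'v \<Rightarrow> 'v" where
  "restrict_map S \<phi> = (\<lambda>v. if v \<in> S then \<phi> v else 0)"

lemma restrict_map_mem:
  assumes "\<phi> \<in> linear_maps T Y" "S \<subseteq> T" "subspace S"
  shows "restrict_map S \<phi> \<in> linear_maps S Y"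
  using assms unfolding linear_maps_def restrict_map_def
  by (auto simp: subspace_add subspace_scale subset_iff)

text \<open>As \<open>x \<notin> S\<close>, the coefficient of \<open>x\<close> in a vector of
  \<open>span (insert x S)\<close> is unique, which leaves the value at \<open>x\<close>
  free.\<close>

lemma linear_maps_extend:
  assumes "subspace S" "x \<notin> S" "subspace Y" and \<psi>: "\<psi> \<in> linear_maps S Y" and "y \<in> Y"
  obtains \<phi> where "\<phi> \<in> linear_maps (span (insert x S)) Y" "restrict_map S \<phi> = \<psi>" "\<phi> x = y"
proof -
  define coef where "coef v = (THE c. v - c *s x \<in> S)" for v
  have coef: "coef v = c" if "v - c *s x \<in> S" for v c
    unfolding coef_def using that coefficient_unique[OF assms(1,2)] by blast
  have decomp: "v - coef v *s x \<in> S" if "v \<in> span (insert x S)" for v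
    using that coef assms(1) mem_span_insert_subspace by metis
  define \<phi> where
    "\<phi> v = (if v \<in> span (insert x S) then \<psi> (v - coef v *s x) + coef v *s y else 0)" for v
  \<comment> \<open>In this form sums and multiples need only some valid coefficient,
    \<open>c + d\<close> and \<open>a * d\<close> below, instead of the value of
    \<open>coef\<close>.\<close>
  have ev: "\<phi> v = \<psi> (v - c *s x) + c *s y" if "v - c *s x \<in> S" for v c
    using that coef[OF that] assms(1) mem_span_insert_subspace[of S v x] by (auto simp: \<phi>_def)
  have "\<phi> \<in> linear_maps (span (insert x S)) Y"
    unfolding linear_maps_def
  proof (intro CollectI conjI ballI allI impI)
    fix u v assume "u \<in> span (insert x S)" "v \<in> span (insert x S)"
    then obtain c d where c: "u - c *s x \<in> S" and d: "v - d *s x \<in> S"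
      using decomp by blast
    have eq: "(u + v) - (c + d) *s x = (u - c *s x) + (v - d *s x)"
      by (simp add: scale_left_distrib)
    have "(u + v) - (c + d) *s x \<in> S"
      unfolding eq using c d assms(1) subspace_add by blast
    then have "\<phi> (u + v) = \<psi> ((u + v) - (c + d) *s x) + (c + d) *s y"
      by (rule ev)
    also have "\<dots> = \<phi> u + \<phi> v"
      unfolding eq ev[OF c] ev[OF d] linear_maps_add[OF \<psi> c d]
      by (simp add: scale_left_distrib)
    finally show "\<phi> (u + v) = \<phi> u + \<phi> v" .
  next
    fix a v assume "v \<in> span (insert x S)"
    then obtain d where d: "v - d *s x \<in> S"
      using decomp by blast
    have eq: "a *s v - (a * d) *s x = a *s (v - d *s x)"
      by (simp add: scale_right_diff_distrib)
    have "a *s v - (a * d) *s x \<in> S"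
      unfolding eq using d assms(1) subspace_scale by blast
    then have "\<phi> (a *s v) = \<psi> (a *s v - (a * d) *s x) + (a * d) *s y"
      by (rule ev)
    also have "\<dots> = a *s \<phi> v"
      unfolding eq ev[OF d] linear_maps_scale[OF \<psi> d] by (simp add: scale_right_distrib)
    finally show "\<phi> (a *s v) = a *s \<phi> v" .
  next
    show "\<phi> ` span (insert x S) \<subseteq> Y"
    proof clarify
      fix v assume "v \<in> span (insert x S)"
      then obtain d where d: "v - d *s x \<in> S"
        using decomp by blast
      show "\<phi> v \<in> Y"
        unfolding ev[OF d]
        using linear_maps_mem[OF \<psi> d] assms(3,5) by (simp add: subspace_add subspace_scale)
    qed
  qed (simp add: \<phi>_def)
  moreover have "restrict_map S \<phi> = \<psi>"
  proof
    fix v show "restrict_map S \<phi> v = \<psi> v"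
      using ev[of v 0] linear_maps_outside[OF \<psi>] by (auto simp: restrict_map_def)
  qed
  moreover have "\<phi> x = y"
    using ev[of x 1] subspace_0[OF assms(1)] linear_maps_zero[OF \<psi> assms(1)] by simp
  ultimately show ?thesis
    using that by blast
qed

lemma linear_maps_span_insert_eval:
  assumes "subspace S" and \<phi>: "\<phi> \<in> linear_maps (span (insert x S)) Y" and c: "v - c *s x \<in> S"
  shows "\<phi> v = \<phi> (v - c *s x) + c *s \<phi> x"
proof -
  have x: "x \<in> span (insert x S)" and v: "v - c *s x \<in> span (insert x S)"
    using c by (auto intro: span_base)
  have "\<phi> ((v - c *s x) + c *s x) = \<phi> (v - c *s x) + \<phi> (c *s x)"
    using v span_scale[OF x] by (rule linear_maps_add[OF \<phi>])
  then show ?thesis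
    using linear_maps_scale[OF \<phi> x] by simp
qed

lemma linear_maps_span_insert_bij:
  assumes "subspace S" "x \<notin> S" "subspace Y"
  shows "bij_betw (\<lambda>\<phi>. (restrict_map S \<phi>, \<phi> x)) (linear_maps (span (insert x S)) Y)
    (linear_maps S Y \<times> Y)"
proof (rule bij_betw_imageI)
  let ?T = "span (insert x S)" and ?r = "\<lambda>\<phi>. (restrict_map S \<phi>, \<phi> x)"
  have ST: "S \<subseteq> ?T" "x \<in> ?T"
    by (auto intro: span_base)
  show "inj_on ?r (linear_maps ?T Y)"
  proof (rule inj_onI)
    fix \<phi> \<psi> assume \<phi>: "\<phi> \<in> linear_maps ?T Y" and \<psi>: "\<psi> \<in> linear_maps ?T Y"
      and eq: "?r \<phi> = ?r \<psi>"
    show "\<phi> = \<psi>"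
    proof
      fix v show "\<phi> v = \<psi> v"
      proof (cases "v \<in> ?T")
        case True
        then obtain c where c: "v - c *s x \<in> S"
          using assms(1) mem_span_insert_subspace by blast
        then have "\<phi> (v - c *s x) = \<psi> (v - c *s x)"
          using eq by (simp add: restrict_map_def fun_eq_iff) metis
        moreover have "\<phi> v = \<phi> (v - c *s x) + c *s \<phi> x" "\<psi> v = \<psi> (v - c *s x) + c *s \<psi> x"
          using \<phi> \<psi> linear_maps_span_insert_eval[OF assms(1) _ c] by blast+
        ultimately show ?thesis
          using eq by simp
      qed (simp add: linear_maps_outside[OF \<phi>] linear_maps_outside[OF \<psi>])
    qed
  qed
  show "?r ` linear_maps ?T Y = linear_maps S Y \<times> Y"
  proof (intro equalityI subsetI)
    fix z assume "z \<in> ?r ` linear_maps ?T Y"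
    then show "z \<in> linear_maps S Y \<times> Y"
      using restrict_map_mem[OF _ ST(1) assms(1)] linear_maps_mem ST(2) by auto
  next
    fix z assume "z \<in> linear_maps S Y \<times> Y"
    then obtain \<psi> y where "z = (\<psi>, y)" "\<psi> \<in> linear_maps S Y" "y \<in> Y"
      by auto
    moreover obtain \<phi> where "\<phi> \<in> linear_maps ?T Y" "restrict_map S \<phi> = \<psi>" "\<phi> x = y"
      using linear_maps_extend[OF assms] calculation(2,3) by blast
    ultimately show "z \<in> ?r ` linear_maps ?T Y"
      by (intro rev_image_eqI[of \<phi>]) auto
  qed
qed

lemma linear_maps_singleton_0: "subspace Y \<Longrightarrow> linear_maps {0} Y = {\<lambda>_. 0}"
  by (auto simp: linear_maps_def fun_eq_iff subspace_0) (metis add_cancel_right_left)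

lemma finite_linear_maps:
  assumes "finite S" "finite Y"
  shows "finite (linear_maps S Y)"
proof (rule finite_subset)
  show "linear_maps S Y \<subseteq> {\<phi>. \<forall>v. (v \<in> S \<longrightarrow> \<phi> v \<in> Y) \<and> (v \<notin> S \<longrightarrow> \<phi> v = 0)}"
    by (auto simp: linear_maps_def)
  show "finite {\<phi>. \<forall>v. (v \<in> S \<longrightarrow> \<phi> v \<in> Y) \<and> (v \<notin> S \<longrightarrow> \<phi> v = 0)}"
    by (rule finite_set_of_finite_funs[OF assms])
qed

text \<open>A map on the larger space amounts to a map on \<open>S\<close> together with a free
  value at \<open>x\<close>; the sum runs over the former and counts the latter.\<close>

lemma card_linear_maps_span_insert:
  assumes "subspace S" "finite S" "x \<notin> S" "subspace Y" "finite Y"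
  shows "card {\<phi> \<in> linear_maps (span (insert x S)) Y. P (restrict_map S \<phi>) (\<phi> x)} =
    (\<Sum>\<psi>\<in>linear_maps S Y. card {y \<in> Y. P \<psi> y})"
proof -
  let ?r = "\<lambda>\<phi>. (restrict_map S \<phi>, \<phi> x)" and ?H = "linear_maps (span (insert x S)) Y"
  have "bij_betw ?r {\<phi> \<in> ?H. P (restrict_map S \<phi>) (\<phi> x)} (SIGMA \<psi>:linear_maps S Y. {y \<in> Y. P \<psi> y})"
  proof (rule bij_betw_imageI)
    note bij = linear_maps_span_insert_bij[OF assms(1,3,4)]
    show "inj_on ?r {\<phi> \<in> ?H. P (restrict_map S \<phi>) (\<phi> x)}"
      by (rule inj_on_subset[OF bij_betw_imp_inj_on[OF bij]]) auto
    have "?r ` {\<phi> \<in> ?H. P (restrict_map S \<phi>) (\<phi> x)} = {z \<in> ?r ` ?H. P (fst z) (snd z)}"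
      by auto
    then show "?r ` {\<phi> \<in> ?H. P (restrict_map S \<phi>) (\<phi> x)} = (SIGMA \<psi>:linear_maps S Y. {y \<in> Y. P \<psi> y})"
      unfolding bij_betw_imp_surj_on[OF bij] by auto
  qed
  then have "card {\<phi> \<in> ?H. P (restrict_map S \<phi>) (\<phi> x)} =
      card (SIGMA \<psi>:linear_maps S Y. {y \<in> Y. P \<psi> y})"
    by (rule bij_betw_same_card)
  also have "\<dots> = (\<Sum>\<psi>\<in>linear_maps S Y. card {y \<in> Y. P \<psi> y})"
    using assms finite_linear_maps by (intro card_SigmaI) auto
  finally show ?thesis .
qed

text \<open>The exponent \<open>j\<close> is the codimension of \<open>T\<close>: every vector of
  \<open>B\<close> outside the span so far contributes one factor \<open>CARD('f)\<close> to the
  span and one factor \<open>card Y\<close>, for its free image, to the number of maps.\<close>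

lemma card_linear_maps_vanishing:
  assumes "subspace T" "finite T" "finite B"
  shows "\<exists>j. card (span (T \<union> B)) = CARD('f) ^ j * card T \<and>
    (\<forall>Y. subspace Y \<longrightarrow> finite Y \<longrightarrow>
      card {\<phi> \<in> linear_maps (span (T \<union> B)) Y. \<forall>v\<in>T. \<phi> v = 0} = card Y ^ j)"
  using assms(3)
proof (induction B rule: finite_induct)
  case empty
  have "{\<phi> \<in> linear_maps T Y. \<forall>v\<in>T. \<phi> v = 0} = {\<lambda>_. 0}" if "subspace Y" for Y
    using that by (fastforce simp: linear_maps_def fun_eq_iff subspace_0)
  then show ?case
    using assms(1) by (intro exI[of _ 0]) (simp add: span_eq_iff[THEN iffD2])
next
  case (insert x B)
  let ?S = "span (T \<union> B)"
  have sp: "span (T \<union> insert x B) = span (insert x ?S)"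
    by (simp add: span_insert_span)
  have fin: "finite ?S"
    using assms insert by (simp add: finite_span)
  from insert.IH obtain j where j: "card ?S = CARD('f) ^ j * card T"
    "\<And>Y. subspace Y \<Longrightarrow> finite Y \<Longrightarrow> card {\<phi> \<in> linear_maps ?S Y. \<forall>v\<in>T. \<phi> v = 0} = card Y ^ j"
    by blast
  show ?case
  proof (cases "x \<in> ?S")
    case True
    then have "span (T \<union> insert x B) = ?S"
      unfolding sp by (simp add: insert_absorb span_span)
    with j show ?thesis
      by auto
  next
    case False
    have "card {\<phi> \<in> linear_maps (span (insert x ?S)) Y. \<forall>v\<in>T. \<phi> v = 0} = card Y ^ Suc j"
      if Y: "subspace Y" "finite Y" for Y
    proof -
      have "{\<phi> \<in> linear_maps (span (insert x ?S)) Y. \<forall>v\<in>T. \<phi> v = 0} =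
          {\<phi> \<in> linear_maps (span (insert x ?S)) Y. \<forall>v\<in>T. restrict_map ?S \<phi> v = 0}"
        by (auto simp: restrict_map_def span_base)
      also have "card \<dots> = (\<Sum>\<psi>\<in>linear_maps ?S Y. card {y \<in> Y. \<forall>v\<in>T. \<psi> v = 0})"
        using card_linear_maps_span_insert[OF subspace_span fin False Y, where P = "\<lambda>\<psi> _. \<forall>v\<in>T. \<psi> v = 0"] .
      also have "\<dots> = (\<Sum>\<psi>\<in>{\<psi> \<in> linear_maps ?S Y. \<forall>v\<in>T. \<psi> v = 0}. card Y)"
        using fin Y by (intro sum.mono_neutral_cong_right) (auto simp: finite_linear_maps)
      also have "\<dots> = card Y ^ Suc j"
        using j(2)[OF Y] by simp
      finally show ?thesis .
    qed
    moreover have "card (span (insert x ?S)) = CARD('f) ^ Suc j * card T"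
      using card_span_insert[OF subspace_span False] j(1) by simp
    ultimately show ?thesis
      unfolding sp by blast
  qed
qed

end

section \<open>Polynomials that are zero or positive beyond a bound\<close>

definition zero_or_positive_above :: "real \<Rightarrow> real poly \<Rightarrow> bool" where
  "zero_or_positive_above a P \<longleftrightarrow> P = 0 \<or> (\<forall>x>a. poly P x > 0)"

lemma zero_or_positive_above_mult:
  "zero_or_positive_above a P \<Longrightarrow> zero_or_positive_above a Q \<Longrightarrow> zero_or_positive_above a (P * Q)"
  by (auto simp: zero_or_positive_above_def)

lemma zero_or_positive_above_add:
  "zero_or_positive_above a P \<Longrightarrow> zero_or_positive_above a Q \<Longrightarrow> zero_or_positive_above a (P + Q)"
  by (auto simp: zero_or_positive_above_def add_pos_pos)

lemma zero_or_positive_above_sum: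
  "(\<And>i. i \<in> A \<Longrightarrow> zero_or_positive_above a (f i)) \<Longrightarrow> zero_or_positive_above a (sum f A)"
  by (induction A rule: infinite_finite_induct)
    (auto intro: zero_or_positive_above_add simp: zero_or_positive_above_def[of _ 0])

context finite_field_space
begin

text \<open>The fibres on \<open>I\<close> are cosets of the kernel. Hence the zeros of
  \<open>\<phi>\<close> in \<open>I\<close> determine the size of the image of \<open>I\<close>, and
  the number of extensions of a map will depend on its zero set alone.\<close>

lemma card_image_times_card_kernel:
  assumes \<phi>: "\<phi> \<in> linear_maps S Y" and "subspace S" "subspace I" "I \<subseteq> S" "finite I"
  shows "card I = card (\<phi> ` I) * card {v \<in> I. \<phi> v = 0}"
proof (rule card_eq_card_image_times_fibre[OF assms(5)])
  fix y assume "y \<in> \<phi> ` I"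
  then obtain u where u: "u \<in> I" "y = \<phi> u"
    by blast
  have "bij_betw (\<lambda>v. u + v) {v \<in> I. \<phi> v = 0} {v \<in> I. \<phi> v = y}"
  proof (rule bij_betw_byWitness[where f' = "\<lambda>v. v - u"])
    show "(\<lambda>v. u + v) ` {v \<in> I. \<phi> v = 0} \<subseteq> {v \<in> I. \<phi> v = y}"
      using u assms linear_maps_add[OF \<phi>] by (auto simp: subspace_add subset_iff)
    show "(\<lambda>v. v - u) ` {v \<in> I. \<phi> v = y} \<subseteq> {v \<in> I. \<phi> v = 0}"
      using u assms linear_maps_diff[OF \<phi>] by (auto simp: subspace_diff subset_iff)
  qed auto
  then show "card {v \<in> I. \<phi> v = y} = card {v \<in> I. \<phi> v = 0}"
    by (rule bij_betw_same_card[symmetric])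
qed

section \<open>Chordal configurations\<close>

text \<open>
  The vector space analogue of a chordal graph: every new vector \<open>x\<close> is joined to a
  subspace \<open>I\<close> (playing the role of a clique) of the configuration \<open>N\<close> built so far.
\<close>

inductive chordal :: "nat \<Rightarrow> 'v set \<Rightarrow> 'v set \<Rightarrow> bool" for k where
  zero: "chordal k {0} {0}"
| extend: "chordal k (span (insert x S)) (N \<union> span (insert x I))"
  if "chordal k S N" "x \<notin> S" "subspace I" "I \<subseteq> N" "CARD('f) * card I \<le> CARD('f) ^ k"

lemma chordal_subset: "chordal k S N \<Longrightarrow> N \<subseteq> S"
proof (induction rule: chordal.induct)
  case (extend S N x I)
  have "span (insert x I) \<subseteq> span (insert x S)"
    using extend by (intro span_mono) auto
  moreover have "N \<subseteq> span (insert x S)"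
    using extend by (auto intro: span_base)
  ultimately show ?case
    by blast
qed simp

lemma chordal_subspace: "chordal k S N \<Longrightarrow> subspace S"
  by (induction rule: chordal.induct) auto

lemma chordal_finite: "chordal k S N \<Longrightarrow> finite S"
  by (induction rule: chordal.induct) (auto intro: finite_span_insert chordal_subspace)

text \<open>\<open>W\<close> is exhausted by vectors \<open>x\<close> outside the current
  \<open>S\<close>, each joined to \<open>W \<inter> S\<close>, the part of \<open>W\<close> reached
  so far. This part lies in \<open>N\<close> by the last hypothesis, and its span with
  \<open>x\<close> stays inside \<open>W\<close>, which gives the size bound.\<close>

lemma chordal_add_subspace:
  assumes "chordal k S N" "subspace W" "finite W" "card W \<le> CARD('f) ^ k" "W \<inter> S \<subseteq> N"
  shows "chordal k (span (S \<union> W)) (N \<union> W)"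
  using assms
proof (induction "card (W - S)" arbitrary: S N rule: less_induct)
  case (less S N)
  have S: "subspace S"
    using less.prems(1) by (rule chordal_subspace)
  show ?case
  proof (cases "W \<subseteq> S")
    case True
    then have "span (S \<union> W) = S" "N \<union> W = N"
      using less.prems(5) S by (auto simp: sup.absorb1 span_eq_iff[THEN iffD2])
    then show ?thesis
      using less.prems(1) by simp
  next
    case False
    then obtain x where x: "x \<in> W" "x \<notin> S"
      by blast
    let ?I = "W \<inter> S" and ?S = "span (insert x S)"
    have I: "subspace ?I"
      using S less.prems(2) by (rule subspace_inter[rotated])
    have JW: "span (insert x ?I) \<subseteq> W"
      using x less.prems(2) by (intro span_minimal) auto
    have "CARD('f) * card ?I = card (span (insert x ?I))"
      using card_span_insert[OF I] x by simp
    also have "\<dots> \<le> CARD('f) ^ k"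
      using card_mono[OF less.prems(3) JW] less.prems(4) by linarith
    finally have good: "chordal k ?S (N \<union> span (insert x ?I))"
      using less.prems x I by (intro chordal.extend) auto
    \<comment> \<open>Modular law: since \<open>x \<in> W\<close>, multiples of \<open>x\<close> can
      be subtracted inside \<open>W\<close>. Hence the condition on the intersection holds again for
      the enlarged space and configuration, as the induction requires.\<close>
    have "W \<inter> ?S \<subseteq> span (insert x ?I)"
    proof
      fix w assume w: "w \<in> W \<inter> ?S"
      then obtain c where "w - c *s x \<in> S"
        using S mem_span_insert_subspace by blast
      moreover have "w - c *s x \<in> W"
        using w x less.prems(2) subspace_diff subspace_scale by blast
      ultimately show "w \<in> span (insert x ?I)"
        using I mem_span_insert_subspace by blast
    qed
    moreover have "card (W - ?S) < card (W - S)"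
      using x less.prems(3) by (intro psubset_card_mono) (auto intro: span_base)
    ultimately have "chordal k (span (?S \<union> W)) (N \<union> span (insert x ?I) \<union> W)"
      using less.prems good by (intro less.hyps) auto
    moreover have "span (?S \<union> W) = span (S \<union> W)"
      using x by (auto simp: span_eq span_base span_superset subset_iff
          intro: span_mono[THEN subsetD, of "insert x S"])
    moreover have "N \<union> span (insert x ?I) \<union> W = N \<union> W"
      using JW by blast
    ultimately show ?thesis
      by simp
  qed
qed

section \<open>Zero sets of linear maps on a chordal configuration\<close>

text \<open>Up to a scalar, a vector of \<open>span (insert x I)\<close> outside \<open>I\<close> is
  \<open>x - i\<close> with \<open>i \<in> I\<close>, and it is killed exactly when \<open>x\<close>
  is sent to \<open>\<psi> i\<close>. So having no new zeros means avoiding the image of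
  \<open>I\<close>. One new zero \<open>v\<close> fixes the value at \<open>x\<close>, and with it
  all zeros in \<open>span (insert x I)\<close>: they are the sums of a multiple of \<open>v\<close>
  and a zero in \<open>I\<close>.\<close>

lemma chordal_zero_set_extensions:
  assumes "subspace S" "x \<notin> S" "subspace Y" "finite Y" "subspace I" "finite I" "I \<subseteq> N" "N \<subseteq> S"
    and K: "K \<subseteq> N \<union> span (insert x I)"
  defines "A \<equiv> \<lambda>\<psi>. {y \<in> Y. \<exists>\<phi>\<in>linear_maps (span (insert x S)) Y.
      restrict_map S \<phi> = \<psi> \<and> \<phi> x = y \<and> {v \<in> N \<union> span (insert x I). \<phi> v = 0} = K}"
  assumes \<psi>: "\<psi> \<in> linear_maps S Y" "{v \<in> N. \<psi> v = 0} = K \<inter> N"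
  shows "K \<inter> span (insert x I) \<subseteq> I \<Longrightarrow> card (A \<psi>) = card Y - card (\<psi> ` I)" (is "?C1 \<Longrightarrow> _")
    and "v \<in> K \<Longrightarrow> v \<in> span (insert x I) \<Longrightarrow> v \<notin> I \<Longrightarrow> card (A \<psi>) =
      (if K \<inter> span (insert x I) = {w \<in> span (insert x I). \<exists>d. w - d *s v \<in> I \<inter> K} then 1 else 0)"
proof -
  let ?H = "linear_maps (span (insert x S)) Y" and ?J = "span (insert x I)"
  have IS: "I \<subseteq> S" "x \<notin> I"
    using assms(2,7,8) by auto
  then have JS: "?J \<subseteq> span (insert x S)"
    by (intro span_mono) auto
  have xS: "x \<in> span (insert x S)" "x \<in> ?J" and IJ: "I \<subseteq> ?J"
    by (auto intro: span_base)
  have on_S: "\<phi> u = \<psi> u" if "restrict_map S \<phi> = \<psi>" "u \<in> S" for \<phi> u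
    using that by (auto simp: restrict_map_def)
  have on_N: "\<phi> u = 0 \<longleftrightarrow> u \<in> K" if "restrict_map S \<phi> = \<psi>" "u \<in> N" for \<phi> u
  proof -
    have "\<phi> u = \<psi> u"
      using on_S[OF that(1)] that(2) assms(8) by blast
    then show ?thesis
      using \<psi>(2) that(2) by auto
  qed
  have on_I: "\<psi> u = 0 \<longleftrightarrow> u \<in> K" if "u \<in> I" for u
    using \<psi>(2) that assms(7) by blast
  {
    assume C1: ?C1
    have "A \<psi> = Y - \<psi> ` I"
    proof (intro equalityI subsetI DiffI)
      fix y assume "y \<in> A \<psi>"
      then obtain \<phi> where \<phi>: "y \<in> Y" "\<phi> \<in> ?H" "restrict_map S \<phi> = \<psi>" "\<phi> x = y"
        "{v \<in> N \<union> ?J. \<phi> v = 0} = K"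
        by (auto simp: A_def)
      show "y \<in> Y"
        by fact
      show "y \<notin> \<psi> ` I"
      proof
        assume "y \<in> \<psi> ` I"
        then obtain i where i: "i \<in> I" "y = \<psi> i"
          by blast
        have "i \<in> S" "i \<in> span (insert x S)"
          using i(1) IS IJ JS by blast+
        then have "\<phi> (x - i) = 0"
          using linear_maps_diff[OF \<phi>(2) subspace_span xS(1)] on_S[OF \<phi>(3)] \<phi>(4) i(2) by simp
        moreover have "x - i \<in> ?J"
          using i xS IJ by (auto intro: span_diff)
        ultimately have "x - i \<in> I"
          using \<phi>(5) C1 by blast
        then have "(x - i) + i \<in> I"
          using i assms(5) subspace_add by blast
        with IS show False
          by simp
      qed
    next
      fix y assume y: "y \<in> Y - \<psi> ` I"
      then obtain \<phi> where \<phi>: "\<phi> \<in> ?H" "restrict_map S \<phi> = \<psi>" "\<phi> x = y"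
        using linear_maps_extend[OF assms(1-3) \<psi>(1)] by blast
      have "v \<in> I" if v: "v \<in> ?J" "\<phi> v = 0" for v
      proof -
        obtain c where c: "v - c *s x \<in> I"
          using v(1) assms(5) mem_span_insert_subspace by blast
        \<comment> \<open>Otherwise \<open>\<phi> v = 0\<close> can be solved for \<open>y\<close>,
          which puts \<open>y\<close> in the image of \<open>I\<close>.\<close>
        have "c = 0"
        proof (rule ccontr)
          assume "c \<noteq> 0"
          have "\<phi> v = \<psi> (v - c *s x) + c *s y"
            using linear_maps_span_insert_eval[OF assms(1) \<phi>(1), of v c] c IS on_S[OF \<phi>(2)] \<phi>(3)
            by auto
          then have "c *s y = - \<psi> (v - c *s x)"
            using v(2) by (simp add: eq_neg_iff_add_eq_0 add.commute)
          then have "inverse c *s (c *s y) = inverse c *s (- \<psi> (v - c *s x))"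
            by simp
          then have "y = (- inverse c) *s \<psi> (v - c *s x)"
            using \<open>c \<noteq> 0\<close> by simp
          also have "\<dots> = \<psi> ((- inverse c) *s (v - c *s x))"
            using linear_maps_scale[OF \<psi>(1)] c IS by (metis subsetD)
          finally show False
            using y c assms(5) subspace_scale by blast
        qed
        with c show ?thesis
          by simp
      qed
      then have "{v \<in> N \<union> ?J. \<phi> v = 0} = K"
        using on_N[OF \<phi>(2)] C1 K assms(7) by blast
      with \<phi> y show "y \<in> A \<psi>"
        by (auto simp: A_def)
    qed
    moreover have "\<psi> ` I \<subseteq> Y" "finite (\<psi> ` I)"
      using linear_maps_mem[OF \<psi>(1)] IS assms(6) by auto
    ultimately show "card (A \<psi>) = card Y - card (\<psi> ` I)"
      by (simp add: card_Diff_subset)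
  }
  {
    assume v: "v \<in> K" "v \<in> ?J" "v \<notin> I"
    let ?Z = "{w \<in> ?J. \<exists>d. w - d *s v \<in> I \<inter> K}"
    obtain c where c: "v - c *s x \<in> I"
      using v(2) assms(5) mem_span_insert_subspace by blast
    with v(3) have c0: "c \<noteq> 0"
      by auto
    have zeros: "{w \<in> ?J. \<phi> w = 0} = ?Z"
      if \<phi>: "\<phi> \<in> ?H" "restrict_map S \<phi> = \<psi>" "\<phi> v = 0" for \<phi>
    proof -
      have ev: "\<phi> w = 0 \<longleftrightarrow> w - d *s v \<in> K" if w: "w - d *s v \<in> I" "w \<in> ?J" for w d
      proof -
        have mem: "w \<in> span (insert x S)" "v \<in> span (insert x S)" "w - d *s v \<in> S"
          using w v(2) JS IS by blast+
        then have "\<phi> (w - d *s v) = \<phi> w - d *s \<phi> v"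
          using linear_maps_diff[OF \<phi>(1) subspace_span mem(1) span_scale[OF mem(2)]]
            linear_maps_scale[OF \<phi>(1) mem(2)] by simp
        then have "\<phi> w = \<psi> (w - d *s v)"
          using \<phi>(3) on_S[OF \<phi>(2) mem(3)] by simp
        then show ?thesis
          using on_I[OF w(1)] by simp
      qed
      \<comment> \<open>The coefficient \<open>c\<close> of \<open>x\<close> in \<open>v\<close> is
        non-zero, so \<open>v\<close> can replace \<open>x\<close> as the generator of
        \<open>?J\<close> over \<open>I\<close>.\<close>
      have "\<exists>d. w - d *s v \<in> I" if w: "w \<in> ?J" for w
      proof -
        obtain e where e: "w - e *s x \<in> I"
          using w assms(5) mem_span_insert_subspace by blast
        have "(w - e *s x) - (e / c) *s (v - c *s x) \<in> I"
          using e c assms(5) subspace_diff subspace_scale by blast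
        moreover have "(w - e *s x) - (e / c) *s (v - c *s x) = w - (e / c) *s v"
          using c0 by (simp add: scale_right_diff_distrib)
        ultimately show ?thesis
          by metis
      qed
      with ev show ?thesis
        by blast
    qed
    have eval_v: "\<phi> v = \<psi> (v - c *s x) + c *s \<phi> x"
      if "\<phi> \<in> ?H" "restrict_map S \<phi> = \<psi>" for \<phi>
      using linear_maps_span_insert_eval[OF assms(1) that(1), of v c] c IS on_S[OF that(2)] by auto
    \<comment> \<open>The only solution \<open>y\<close> of
      \<open>\<psi> (v - c *s x) + c *s y = 0\<close>, which says that \<open>v\<close> is
      killed.\<close>
    define y0 where "y0 = (- inverse c) *s \<psi> (v - c *s x)"
    have y0: "y0 \<in> Y"
      unfolding y0_def using c IS linear_maps_mem[OF \<psi>(1)] assms(3) subspace_scale by blast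
    have "A \<psi> \<subseteq> (if K \<inter> ?J = ?Z then {y0} else {})"
    proof
      fix y assume "y \<in> A \<psi>"
      then obtain \<phi> where \<phi>: "\<phi> \<in> ?H" "restrict_map S \<phi> = \<psi>" "\<phi> x = y"
        and eq: "{v \<in> N \<union> ?J. \<phi> v = 0} = K"
        by (auto simp: A_def)
      have "\<phi> v = 0"
        using eq v by blast
      then have "c *s y = - \<psi> (v - c *s x)"
        using eval_v[OF \<phi>(1,2)] \<phi>(3) by (simp add: eq_neg_iff_add_eq_0 add.commute)
      then have "inverse c *s (c *s y) = inverse c *s (- \<psi> (v - c *s x))"
        by simp
      then have "y = y0"
        using c0 by (simp add: y0_def)
      moreover have "K \<inter> ?J = ?Z"
        unfolding zeros[OF \<phi>(1,2) \<open>\<phi> v = 0\<close>, symmetric] using eq by blast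
      ultimately show "y \<in> (if K \<inter> ?J = ?Z then {y0} else {})"
        by simp
    qed
    moreover have "y0 \<in> A \<psi>" if Z: "K \<inter> ?J = ?Z"
    proof -
      obtain \<phi> where \<phi>: "\<phi> \<in> ?H" "restrict_map S \<phi> = \<psi>" "\<phi> x = y0"
        using linear_maps_extend[OF assms(1-3) \<psi>(1) y0] by blast
      have "\<phi> v = 0"
        using eval_v[OF \<phi>(1,2)] \<phi>(3) c0 by (simp add: y0_def)
      then have "{w \<in> ?J. \<phi> w = 0} = K \<inter> ?J"
        using zeros[OF \<phi>(1,2)] Z by simp
      moreover have "{w \<in> N. \<phi> w = 0} = K \<inter> N"
        using on_N[OF \<phi>(2)] by blast
      ultimately have "{w \<in> N \<union> ?J. \<phi> w = 0} = K"
        using K by blast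
      with \<phi> y0 show ?thesis
        by (auto simp: A_def)
    qed
    ultimately have "A \<psi> = (if K \<inter> ?J = ?Z then {y0} else {})"
      by (auto split: if_splits)
    then show "card (A \<psi>) = (if K \<inter> ?J = ?Z then 1 else 0)"
      by simp
  }
qed

text \<open>Restriction to \<open>S\<close> turns the zero set \<open>K\<close> into
  \<open>K \<inter> N\<close>, so the induction runs over all \<open>K\<close> at once. All
  restrictions with that zero set have equally many suitable extensions, so the polynomial gains one
  factor.\<close>

lemma chordal_zero_set_polynomial:
  assumes "chordal k S N" "k > 0"
  shows "\<exists>P. zero_or_positive_above (real CARD('f) ^ (k - 1)) P \<and>
    (\<forall>Y. subspace Y \<longrightarrow> finite Y \<longrightarrow>
      real (card {\<phi> \<in> linear_maps S Y. {v \<in> N. \<phi> v = 0} = K}) = poly P (card Y))"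
  using assms(1)
proof (induction arbitrary: K rule: chordal.induct)
  case zero
  \<comment> \<open>The only map on \<open>{0}\<close> is zero, with zero set \<open>{0}\<close>;
    any other \<open>K\<close> gets the polynomial 0.\<close>
  show ?case
  proof (cases "K = {0}")
    case True
    then have "{\<phi> \<in> linear_maps {0} Y. {v \<in> {0}. \<phi> v = 0} = K} = {\<lambda>_. 0}" if "subspace Y" for Y
      using linear_maps_singleton_0[OF that] by auto
    then show ?thesis
      by (intro exI[of _ 1]) (simp add: zero_or_positive_above_def)
  next
    case False
    then have empty: "{\<phi> \<in> linear_maps {0} Y. {v \<in> {0}. \<phi> v = 0} = K} = {}" if "subspace Y" for Y
      using linear_maps_singleton_0[OF that] by auto
    show ?thesis
    proof (intro exI[of _ 0] conjI allI impI)
      fix Y assume "subspace Y"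
      then show "real (card {\<phi> \<in> linear_maps {0} Y. {v \<in> {0}. \<phi> v = 0} = K}) = poly 0 (real (card Y))"
        by (simp only: empty) simp
    qed (simp add: zero_or_positive_above_def)
  qed
next
  case (extend S N x I)
  let ?J = "span (insert x I)" and ?H = "linear_maps (span (insert x S))"
  let ?A = "\<lambda>Y \<psi>. {y \<in> Y. \<exists>\<phi>\<in>?H Y.
      restrict_map S \<phi> = \<psi> \<and> \<phi> x = y \<and> {v \<in> N \<union> ?J. \<phi> v = 0} = K}"
  note S = chordal_subspace[OF extend.hyps(1)] and finS = chordal_finite[OF extend.hyps(1)]
    and NS = chordal_subset[OF extend.hyps(1)]
  have finI: "finite I"
    using finS NS extend.hyps(4) by (meson finite_subset)
  obtain P where P: "zero_or_positive_above (real CARD('f) ^ (k - 1)) P"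
    "\<And>Y. subspace Y \<Longrightarrow> finite Y \<Longrightarrow>
      real (card {\<phi> \<in> linear_maps S Y. {v \<in> N. \<phi> v = 0} = K \<inter> N}) = poly P (card Y)"
    using extend.IH[of "K \<inter> N"] by blast
  have count: "real (card {\<phi> \<in> ?H Y. {v \<in> N \<union> ?J. \<phi> v = 0} = K}) = poly (P * Q) (card Y)"
    if Y: "subspace Y" "finite Y"
      and Q: "\<And>\<psi>. \<psi> \<in> linear_maps S Y \<Longrightarrow> {v \<in> N. \<psi> v = 0} = K \<inter> N \<Longrightarrow>
        real (card (?A Y \<psi>)) = poly Q (card Y)" for Y Q
  proof -
    let ?P = "\<lambda>\<psi> y. \<exists>\<phi>\<in>?H Y. restrict_map S \<phi> = \<psi> \<and> \<phi> x = y \<and> {v \<in> N \<union> ?J. \<phi> v = 0} = K"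
    \<comment> \<open>A map is determined by its restriction and its value at \<open>x\<close>, so
      this condition on \<open>\<phi>\<close> is a condition on that pair, the form that can be
      counted fibrewise.\<close>
    have "{v \<in> N \<union> ?J. \<phi> v = 0} = K \<longleftrightarrow> ?P (restrict_map S \<phi>) (\<phi> x)" if "\<phi> \<in> ?H Y" for \<phi>
      using that inj_onD[OF bij_betw_imp_inj_on[OF linear_maps_span_insert_bij[OF S extend.hyps(2) Y(1)]]]
      by (metis (no_types, lifting))
    then have "{\<phi> \<in> ?H Y. {v \<in> N \<union> ?J. \<phi> v = 0} = K} =
        {\<phi> \<in> ?H Y. ?P (restrict_map S \<phi>) (\<phi> x)}"
      by blast
    then have "real (card {\<phi> \<in> ?H Y. {v \<in> N \<union> ?J. \<phi> v = 0} = K}) =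
        (\<Sum>\<psi>\<in>linear_maps S Y. real (card (?A Y \<psi>)))"
      using card_linear_maps_span_insert[OF S finS extend.hyps(2) Y, of ?P] by simp
    also have "\<dots> = (\<Sum>\<psi>\<in>{\<psi> \<in> linear_maps S Y. {v \<in> N. \<psi> v = 0} = K \<inter> N}. real (card (?A Y \<psi>)))"
    proof (intro sum.mono_neutral_right ballI)
      fix \<psi> assume \<psi>: "\<psi> \<in> linear_maps S Y - {\<psi> \<in> linear_maps S Y. {v \<in> N. \<psi> v = 0} = K \<inter> N}"
      \<comment> \<open>As \<open>N \<subseteq> S\<close>, an extension has the same zeros in
        \<open>N\<close> as \<open>\<psi>\<close>. If these are not \<open>K \<inter> N\<close>, no
        extension has zero set \<open>K\<close>.\<close>
      have "?A Y \<psi> = {}"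
      proof (rule ccontr)
        assume "?A Y \<psi> \<noteq> {}"
        then obtain \<phi> where \<phi>: "restrict_map S \<phi> = \<psi>" "{v \<in> N \<union> ?J. \<phi> v = 0} = K"
          by blast
        then have "{v \<in> N. \<psi> v = 0} = {v \<in> N. \<phi> v = 0}"
          using NS by (auto simp: restrict_map_def)
        with \<phi>(2) \<psi> show False
          by blast
      qed
      then show "real (card (?A Y \<psi>)) = 0"
        by (simp only: card.empty of_nat_0)
    qed (use finS Y finite_linear_maps in auto)
    also have "\<dots> = (\<Sum>\<psi>\<in>{\<psi> \<in> linear_maps S Y. {v \<in> N. \<psi> v = 0} = K \<inter> N}. poly Q (card Y))"
      using Q by (intro sum.cong) auto
    also have "\<dots> = poly (P * Q) (card Y)"
      using P(2)[OF Y] by simp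
    finally show ?thesis .
  qed
  \<comment> \<open>One factor \<open>Q\<close> has to serve all \<open>Y\<close> and all
    \<open>\<psi>\<close>, so it is chosen before either is fixed.\<close>
  have "\<exists>Q. zero_or_positive_above (real CARD('f) ^ (k - 1)) Q \<and>
      (\<forall>Y. subspace Y \<longrightarrow> finite Y \<longrightarrow> (\<forall>\<psi>\<in>linear_maps S Y. {v \<in> N. \<psi> v = 0} = K \<inter> N \<longrightarrow>
        real (card (?A Y \<psi>)) = poly Q (card Y)))"
  proof (cases "K \<subseteq> N \<union> ?J")
    case False
    then have "?A Y \<psi> = {}" for Y \<psi>
      by blast
    then show ?thesis
      by (intro exI[of _ 0]) (simp add: zero_or_positive_above_def)
  next
    case K: True
    note ext = chordal_zero_set_extensions[OF S extend.hyps(2) _ _ extend.hyps(3) finI extend.hyps(4) NS K]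
    show ?thesis
    proof (cases "K \<inter> ?J \<subseteq> I")
      case True
      \<comment> \<open>By counting cosets, \<open>a\<close> is the size of the image of
        \<open>I\<close> under every relevant \<open>\<psi>\<close>. It is at most
        \<open>card I\<close>, and joining \<open>x\<close> to \<open>I\<close> multiplies the size
        by \<open>CARD('f)\<close>, which accounts for \<open>k - 1\<close> in place of
        \<open>k\<close>. If \<open>I \<inter> K\<close> is empty, division by 0 makes
        \<open>a\<close> zero, and no such \<open>\<psi>\<close> exists because 0 is always
        killed.\<close>
      define a where "a = real (card I) / real (card (I \<inter> K))"
      have "CARD('f) * card I \<le> CARD('f) * CARD('f) ^ (k - 1)"
        using extend.hyps(5) assms(2) by (metis power_eq_if not_gr_zero)
      then have "card I \<le> CARD('f) ^ (k - 1)"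
        by simp
      then have "real (card I) \<le> real CARD('f) ^ (k - 1)"
        by (metis of_nat_le_iff of_nat_power)
      moreover have "a \<le> real (card I)"
        unfolding a_def using mult_left_mono[of 1 "real (card (I \<inter> K))" "real (card I)"]
        by (cases "card (I \<inter> K) = 0") (auto simp: divide_le_eq)
      ultimately have "a \<le> real CARD('f) ^ (k - 1)"
        by linarith
      then have "zero_or_positive_above (real CARD('f) ^ (k - 1)) [:- a, 1:]"
        by (auto simp: zero_or_positive_above_def)
      moreover have "real (card (?A Y \<psi>)) = poly [:- a, 1:] (card Y)"
        if Y: "subspace Y" "finite Y" and \<psi>: "\<psi> \<in> linear_maps S Y" "{v \<in> N. \<psi> v = 0} = K \<inter> N"
        for Y \<psi>
      proof -
        have IS: "I \<subseteq> S"
          using NS extend.hyps(4) by blast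
        have "{v \<in> I. \<psi> v = 0} = I \<inter> K"
          using \<psi>(2) extend.hyps(4) by blast
        then have "card I = card (\<psi> ` I) * card (I \<inter> K)"
          using card_image_times_card_kernel[OF \<psi>(1) S extend.hyps(3) IS finI] by simp
        moreover have "card I > 0"
          using extend.hyps(3) finI by (rule card_subspace_pos)
        ultimately have "a = real (card (\<psi> ` I))"
          unfolding a_def by (simp add: field_simps)
        moreover have "card (\<psi> ` I) \<le> card Y"
          using linear_maps_mem[OF \<psi>(1)] IS Y(2) by (intro card_mono) auto
        ultimately show ?thesis
          using ext(1)[OF Y \<psi> True] by simp
      qed
      ultimately show ?thesis
        by blast
    next
      case False
      then obtain v where v: "v \<in> K" "v \<in> ?J" "v \<notin> I"
        by blast
      define c :: real where
        "c = (if K \<inter> ?J = {w \<in> ?J. \<exists>d. w - d *s v \<in> I \<inter> K} then 1 else 0)"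
      have "zero_or_positive_above (real CARD('f) ^ (k - 1)) [:c:]"
        by (simp add: zero_or_positive_above_def c_def)
      moreover have "real (card (?A Y \<psi>)) = poly [:c:] (card Y)"
        if "subspace Y" "finite Y" "\<psi> \<in> linear_maps S Y" "{v \<in> N. \<psi> v = 0} = K \<inter> N" for Y \<psi>
        unfolding ext(2)[OF that v] by (simp add: c_def)
      ultimately show ?thesis
        by blast
    qed
  qed
  then obtain Q where "zero_or_positive_above (real CARD('f) ^ (k - 1)) Q"
    "\<And>Y \<psi>. subspace Y \<Longrightarrow> finite Y \<Longrightarrow> \<psi> \<in> linear_maps S Y \<Longrightarrow> {v \<in> N. \<psi> v = 0} = K \<inter> N \<Longrightarrow>
        real (card (?A Y \<psi>)) = poly Q (card Y)"
    by blast
  then show ?case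
    using P(1) count by (intro exI[of _ "P * Q"]) (blast intro: zero_or_positive_above_mult)
qed

text \<open>Since \<open>A \<subseteq> N\<close>, the zero set of a map in \<open>N\<close> decides
  whether it avoids \<open>A\<close>. The count is thus a finite sum over the possible zero sets
  \<open>K \<subseteq> N - A\<close>.\<close>

lemma chordal_avoiding_polynomial:
  assumes "chordal k S N" "k > 0" "A \<subseteq> N"
  shows "\<exists>P. zero_or_positive_above (real CARD('f) ^ (k - 1)) P \<and>
    (\<forall>Y. subspace Y \<longrightarrow> finite Y \<longrightarrow>
      real (card {\<phi> \<in> linear_maps S Y. \<forall>v\<in>A. \<phi> v \<noteq> 0}) = poly P (card Y))"
proof -
  have "\<exists>P. \<forall>K. zero_or_positive_above (real CARD('f) ^ (k - 1)) (P K) \<and>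
    (\<forall>Y. subspace Y \<longrightarrow> finite Y \<longrightarrow>
      real (card {\<phi> \<in> linear_maps S Y. {v \<in> N. \<phi> v = 0} = K}) = poly (P K) (card Y))"
    by (intro choice allI chordal_zero_set_polynomial[OF assms(1,2)])
  then obtain P where P: "\<And>K. zero_or_positive_above (real CARD('f) ^ (k - 1)) (P K)"
    "\<And>K Y. subspace Y \<Longrightarrow> finite Y \<Longrightarrow>
      real (card {\<phi> \<in> linear_maps S Y. {v \<in> N. \<phi> v = 0} = K}) = poly (P K) (card Y)"
    by blast
  have fin: "finite S" "finite N"
    using chordal_finite[OF assms(1)] chordal_subset[OF assms(1)] finite_subset by auto
  have "real (card {\<phi> \<in> linear_maps S Y. \<forall>v\<in>A. \<phi> v \<noteq> 0}) = poly (sum P (Pow (N - A))) (card Y)"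
    if Y: "subspace Y" "finite Y" for Y
  proof -
    have "{\<phi> \<in> linear_maps S Y. \<forall>v\<in>A. \<phi> v \<noteq> 0} =
        (\<Union>K\<in>Pow (N - A). {\<phi> \<in> linear_maps S Y. {v \<in> N. \<phi> v = 0} = K})"
      using assms(3) by auto
    then have "card {\<phi> \<in> linear_maps S Y. \<forall>v\<in>A. \<phi> v \<noteq> 0} =
        (\<Sum>K\<in>Pow (N - A). card {\<phi> \<in> linear_maps S Y. {v \<in> N. \<phi> v = 0} = K})"
      using fin Y finite_linear_maps by (simp only:) (rule card_UN_disjoint, auto)
    then show ?thesis
      using P(2)[OF Y] by (simp add: poly_sum)
  qed
  then show ?thesis
    using zero_or_positive_above_sum[of "Pow (N - A)" _ P] P(1) by blast
qed

end

section \<open>Represented matroids\<close>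

text \<open>The product of \<open>1 - 1\<close> over \<open>Z\<close>, expanded.\<close>

lemma sum_Pow_alternating:
  assumes "finite Z"
  shows "(\<Sum>X\<in>Pow Z. (-1) ^ card X) = (if Z = {} then 1 else 0 :: 'b::comm_ring_1)"
  using prod_diff_conv_sum[OF assms, of "\<lambda>_. 1 :: 'b" "\<lambda>_. 1"] assms
  by (auto simp: power_0_left)

text \<open>Parallel elements may have equal columns, so independence is expressed by coefficients
  indexed by elements and not as independence of the set of columns.\<close>

locale represented_matroid = finite_field_space scale + matroid M
  for scale :: "'f::{finite,field} \<Rightarrow> 'v::ab_group_add \<Rightarrow> 'v" (infixr \<open>*s\<close> 75)
    and M :: "'a pre_matroid" +
  fixes col :: "'a \<Rightarrow> 'v"
  assumes indeps_iff: "X \<subseteq> ground M \<Longrightarrow>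
    X \<in> indeps M \<longleftrightarrow> (\<forall>c. (\<Sum>e\<in>X. c e *s col e) = 0 \<longrightarrow> (\<forall>e\<in>X. c e = 0))"
begin

abbreviation "E \<equiv> ground M"

abbreviation "col_span X \<equiv> span (col ` X)"

lemma finite_subset_ground: "X \<subseteq> E \<Longrightarrow> finite X"
  using finite_ground finite_subset by blast

lemma finite_col_span: "X \<subseteq> E \<Longrightarrow> finite (col_span X)"
  by (simp add: finite_span finite_subset_ground)

section \<open>Rank as the dimension of a span of columns\<close>

lemma mem_col_span:
  assumes "finite X" "v \<in> col_span X"
  shows "\<exists>c. v = (\<Sum>e\<in>X. c e *s col e)"
  using assms
proof (induction X arbitrary: v rule: finite_induct)
  case (insert x X)
  then obtain k where "v - k *s col x \<in> col_span X"
    by (auto simp: span_insert)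
  then obtain c where c: "v - k *s col x = (\<Sum>e\<in>X. c e *s col e)"
    using insert.IH by blast
  have "(\<Sum>e\<in>insert x X. (c(x := k)) e *s col e) = k *s col x + (\<Sum>e\<in>X. (c(x := k)) e *s col e)"
    using insert.hyps by simp
  also have "(\<Sum>e\<in>X. (c(x := k)) e *s col e) = (\<Sum>e\<in>X. c e *s col e)"
    using insert.hyps by (intro sum.cong) auto
  also have "k *s col x + \<dots> = v"
    using c by (simp add: algebra_simps)
  finally show ?case
    by metis
qed simp

text \<open>A linear relation on \<open>insert e X\<close> with non-zero coefficient at
  \<open>e\<close> expresses \<open>col e\<close> by the columns of \<open>X\<close>, and
  conversely.\<close>

lemma indeps_insert_iff:
  assumes "X \<in> indeps M" "e \<in> E" "e \<notin> X"
  shows "insert e X \<in> indeps M \<longleftrightarrow> col e \<notin> col_span X"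
proof -
  have X: "X \<subseteq> E" "finite X"
    using assms(1) indeps_subset finite_subset_ground by auto
  have indep: "\<forall>e\<in>X. c e = 0" if "(\<Sum>e\<in>X. c e *s col e) = 0" for c
    using that assms(1) indeps_iff[OF X(1)] by blast
  have "insert e X \<in> indeps M" if ncol: "col e \<notin> col_span X"
  proof -
    have "\<forall>a\<in>insert e X. c a = 0" if 0: "(\<Sum>a\<in>insert e X. c a *s col a) = 0" for c
    proof -
      have sum: "c e *s col e + (\<Sum>a\<in>X. c a *s col a) = 0"
        using 0 X(2) assms(3) by simp
      have "c e = 0"
      proof (rule ccontr)
        assume "c e \<noteq> 0"
        have "c e *s col e = - (\<Sum>a\<in>X. c a *s col a)"
          using sum by (simp add: eq_neg_iff_add_eq_0)
        also have "\<dots> \<in> col_span X"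
          by (intro span_neg span_sum span_scale span_base) auto
        finally have "inverse (c e) *s c e *s col e \<in> col_span X"
          by (rule span_scale)
        with \<open>c e \<noteq> 0\<close> ncol show False
          by simp
      qed
      with sum indep[of c] show ?thesis
        by simp
    qed
    then show ?thesis
      using indeps_iff[of "insert e X"] X assms(2) by blast
  qed
  moreover have "col e \<notin> col_span X" if ins: "insert e X \<in> indeps M"
  proof
    assume "col e \<in> col_span X"
    then obtain c where c: "col e = (\<Sum>a\<in>X. c a *s col a)"
      using mem_col_span X(2) by blast
    let ?c = "c(e := - 1)"
    have "(\<Sum>a\<in>X. ?c a *s col a) = (\<Sum>a\<in>X. c a *s col a)"
      using assms(3) by (intro sum.cong) auto
    then have "(\<Sum>a\<in>insert e X. ?c a *s col a) = 0"
      using X(2) assms(3) c by simp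
    then have "?c e = 0"
      using indeps_iff[of "insert e X"] ins X assms(2) by blast
    then show False
      by simp
  qed
  ultimately show ?thesis
    by blast
qed

lemma card_col_span_indep: "X \<in> indeps M \<Longrightarrow> card (col_span X) = CARD('f) ^ card X"
proof -
  assume X: "X \<in> indeps M"
  then have "finite X"
    using indeps_subset finite_subset_ground by blast
  then show ?thesis
    using X
  proof (induction X rule: finite_induct)
    case (insert e X)
    then have X: "X \<in> indeps M" and "e \<in> E"
      using indeps_down indeps_subset by blast+
    then have "col e \<notin> col_span X"
      using indeps_insert_iff insert by blast
    then have "card (span (insert (col e) (col_span X))) = CARD('f) * card (col_span X)"
      by (intro card_span_insert) auto
    with X insert show ?case
      by (simp add: span_insert_span)
  qed simp
qed

text \<open>A largest independent subset of \<open>X\<close> spans all columns of \<open>X\<close>,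
  because an element with its column outside that span would enlarge it.\<close>

lemma card_col_span:
  assumes "X \<subseteq> E"
  shows "card (col_span X) = CARD('f) ^ rk M X"
proof -
  let ?I = "{Y \<in> indeps M. Y \<subseteq> X}"
  have "?I \<subseteq> Pow E"
    using assms by auto
  then have fin: "finite (card ` ?I)"
    using finite_ground by (meson finite_Pow_iff finite_imageI finite_subset)
  moreover have "card ` ?I \<noteq> {}"
    using empty_indep by blast
  ultimately have "rk M X \<in> card ` ?I"
    unfolding rk_def by (rule Max_in)
  then obtain Y where Y: "Y \<in> indeps M" "Y \<subseteq> X" "rk M X = card Y"
    by auto
  have finY: "finite Y"
    using Y assms finite_subset_ground by blast
  have "col e \<in> col_span Y" if e: "e \<in> X" for e
  proof (cases "e \<in> Y")
    case True
    then show ?thesis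
      by (simp add: span_base)
  next
    case False
    have "insert e Y \<notin> indeps M"
    proof
      assume "insert e Y \<in> indeps M"
      then have "card (insert e Y) \<in> card ` ?I"
        using e Y by auto
      then have "card (insert e Y) \<le> rk M X"
        unfolding rk_def using fin by (rule Max_ge[rotated])
      then show False
        using False finY Y(3) by simp
    qed
    with False e Y assms indeps_insert_iff show ?thesis
      by blast
  qed
  then have "col_span X = col_span Y"
    using Y(2) by (auto simp: span_eq intro: span_base)
  then show ?thesis
    using card_col_span_indep Y by simp
qed

lemma rk_less_iff:
  assumes "X \<subseteq> E" "e \<in> E"
  shows "rk M X < rk M (insert e X) \<longleftrightarrow> col e \<notin> col_span X"
proof -
  have "rk M X < rk M (insert e X) \<longleftrightarrow> card (col_span X) < card (col_span (insert e X))"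
    using assms card_col_span[of X] card_col_span[of "insert e X"] one_less_card_field by simp
  also have "col_span (insert e X) = span (insert (col e) (col_span X))"
    by (simp add: span_insert_span)
  also have "card (col_span X) < card \<dots> \<longleftrightarrow> col e \<notin> col_span X"
  proof (cases "col e \<in> col_span X")
    case True
    then show ?thesis
      by (simp add: insert_absorb span_span)
  next
    case False
    then show ?thesis
      using card_span_insert[OF subspace_span False] one_less_card_field
        card_subspace_pos[OF subspace_span finite_col_span[OF assms(1)]] by simp
  qed
  finally show ?thesis .
qed

section \<open>Closure, flats and the Moebius function\<close>

definition closure :: "'a set \<Rightarrow> 'a set" where
  "closure X = {e \<in> E. col e \<in> col_span X}"

lemma flats_iff: "F \<in> flats M \<longleftrightarrow> F \<subseteq> E \<and> closure F = F"
proof -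
  have "F \<in> flats M \<longleftrightarrow> F \<subseteq> E \<and> (\<forall>e\<in>E - F. col e \<notin> col_span F)"
    using rk_less_iff by (auto simp: flats_def)
  then show ?thesis
    by (auto simp: closure_def intro: span_base)
qed

lemma subset_closure: "X \<subseteq> E \<Longrightarrow> X \<subseteq> closure X"
  by (auto simp: closure_def intro: span_base)

lemma closure_mono: "X \<subseteq> Y \<Longrightarrow> closure X \<subseteq> closure Y"
  using span_mono[of "col ` X" "col ` Y"] by (auto simp: closure_def)

lemma closure_subset_ground: "closure X \<subseteq> E"
  by (auto simp: closure_def)

lemma col_span_closure:
  assumes "X \<subseteq> E"
  shows "col_span (closure X) = col_span X"
proof -
  have "col ` closure X \<subseteq> col_span X"
    by (auto simp: closure_def)
  moreover have "col ` X \<subseteq> col_span (closure X)"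
    using subset_closure[OF assms] by (auto intro: span_base)
  ultimately show ?thesis
    by (simp add: span_eq)
qed

lemma closure_in_flats: "X \<subseteq> E \<Longrightarrow> closure X \<in> flats M"
  using col_span_closure[of X] closure_subset_ground by (auto simp: flats_iff closure_def)

lemma rk_closure:
  assumes "X \<subseteq> E"
  shows "rk M (closure X) = rk M X"
proof -
  have "CARD('f) ^ rk M (closure X) = CARD('f) ^ rk M X"
    using card_col_span[OF assms] card_col_span[OF closure_subset_ground[of X]] col_span_closure[OF assms]
    by simp
  then show ?thesis
    using one_less_card_field by simp
qed

lemma closure_empty:
  assumes "loopless M"
  shows "closure {} = {}"
  using assms indeps_insert_iff[OF empty_indep] by (auto simp: closure_def loopless_def)

text \<open>The right-hand side satisfies the recursion of the Moebius function: summed over the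
  flats inside \<open>F\<close> it meets each subset of \<open>F\<close> once, at its closure, and
  the alternating sum over the subsets of a non-empty \<open>F\<close> is 0. Looplessness makes
  \<open>{}\<close> a flat, which is the closure of \<open>{}\<close> only.\<close>

lemma moebius_eq_sum_closure:
  assumes "loopless M" "F \<in> flats M"
  shows "moebius (flats M) {} F = (\<Sum>X | X \<subseteq> E \<and> closure X = F. (-1) ^ card X)"
  using assms(2)
proof (induction "card F" arbitrary: F rule: less_induct)
  case (less F)
  let ?g = "\<lambda>F. \<Sum>X | X \<subseteq> E \<and> closure X = F. (-1) ^ card X :: int"
  have F: "F \<subseteq> E" "closure F = F" "finite F"
    using less.prems flats_iff finite_subset_ground by auto
  show ?case
  proof (cases "F = {}")
    case True
    have "X = {}" if "X \<subseteq> E" "closure X = {}" for X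
      using that subset_closure by auto
    then have "{X. X \<subseteq> E \<and> closure X = F} = {{}}"
      using True closure_empty[OF assms(1)] by auto
    then show ?thesis
      using True by (simp add: moebius.simps)
  next
    case False
    have fin: "finite {Z \<in> flats M. Z \<subseteq> F}"
      using F(3) by simp
    have "(\<Sum>Z\<in>{Z \<in> flats M. Z \<subseteq> F}. ?g Z) = (\<Sum>X\<in>Pow F. (-1) ^ card X)"
    proof -
      have "{X. X \<subseteq> E \<and> closure X = Z} = {X \<in> Pow F. closure X = Z}" if "Z \<subseteq> F" for Z
        using that subset_closure F(1) by auto
      then have "(\<Sum>Z\<in>{Z \<in> flats M. Z \<subseteq> F}. ?g Z) =
          (\<Sum>Z\<in>{Z \<in> flats M. Z \<subseteq> F}. \<Sum>X\<in>{X \<in> Pow F. closure X = Z}. (-1) ^ card X)"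
        by (intro sum.cong) auto
      also have "\<dots> = (\<Sum>X\<in>Pow F. (-1) ^ card X)"
      proof (rule sum.group)
        show "closure ` Pow F \<subseteq> {Z \<in> flats M. Z \<subseteq> F}"
          using closure_mono[of _ F] F closure_in_flats by auto
      qed (use F fin in auto)
      finally show ?thesis .
    qed
    also have "\<dots> = 0"
      using sum_Pow_alternating[OF F(3)] False by simp
    finally have "?g F = - (\<Sum>Z\<in>{Z \<in> flats M. Z \<subseteq> F} - {F}. ?g Z)"
      using fin less.prems by (simp add: sum.remove[of _ F])
    also have "{Z \<in> flats M. Z \<subseteq> F} - {F} = {Z \<in> flats M. {} \<subseteq> Z \<and> Z \<subset> F}"
      by auto
    also have "- (\<Sum>Z\<in>\<dots>. ?g Z) = - (\<Sum>Z\<in>{Z \<in> flats M. {} \<subseteq> Z \<and> Z \<subset> F}. moebius (flats M) {} Z)"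
      using less.hyps F(3) by (intro arg_cong[of _ _ uminus] sum.cong) (auto simp: psubset_card_mono)
    also have "\<dots> = moebius (flats M) {} F"
      using False F(3) by (subst (2) moebius.simps) auto
    finally show ?thesis
      by simp
  qed
qed

text \<open>Subsets are grouped by their closure, a flat of the same rank. This is Whitney's
  expansion, the form suited to inclusion-exclusion.\<close>

lemma characteristic_poly_expansion:
  assumes "loopless M"
  shows "characteristic_poly M = (\<Sum>X\<in>Pow E. monom ((-1) ^ card X) (rk M E - rk M X))"
proof -
  have "characteristic_poly M =
      (\<Sum>F\<in>flats M. monom (of_int (\<Sum>X | X \<subseteq> E \<and> closure X = F. (-1) ^ card X)) (rk M E - rk M F))"
    using assms moebius_eq_sum_closure by (simp add: characteristic_poly_def cong: sum.cong)
  also have "\<dots> = (\<Sum>F\<in>flats M. \<Sum>X\<in>{X \<in> Pow E. closure X = F}. monom ((-1) ^ card X) (rk M E - rk M X))"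
  proof (intro sum.cong refl)
    fix F
    have "monom (of_int (\<Sum>X | X \<subseteq> E \<and> closure X = F. (-1) ^ card X)) (rk M E - rk M F) =
        (\<Sum>X\<in>{X \<in> Pow E. closure X = F}. monom ((-1) ^ card X :: real) (rk M E - rk M F))"
      by (simp add: monom_sum)
    also have "\<dots> = (\<Sum>X\<in>{X \<in> Pow E. closure X = F}. monom ((-1) ^ card X) (rk M E - rk M X))"
      using rk_closure by (intro sum.cong) auto
    finally show "monom (of_int (\<Sum>X | X \<subseteq> E \<and> closure X = F. (-1) ^ card X)) (rk M E - rk M F) =
        (\<Sum>X\<in>{X \<in> Pow E. closure X = F}. monom ((-1) ^ card X :: real) (rk M E - rk M X))" .
  qed
  also have "\<dots> = (\<Sum>X\<in>Pow E. monom ((-1) ^ card X) (rk M E - rk M X))"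
  proof (rule sum.group)
    have "flats M \<subseteq> Pow E"
      by (auto simp: flats_def)
    then show "finite (flats M)"
      using finite_ground by (meson finite_Pow_iff finite_subset)
  qed (use finite_ground closure_in_flats in auto)
  finally show ?thesis .
qed

section \<open>The characteristic polynomial as a count of linear maps\<close>

text \<open>The kernel is a subspace, so vanishing on the columns of \<open>X\<close> is vanishing
  on their span, whose codimension is \<open>rk M E - rk M X\<close>.\<close>

lemma card_linear_maps_vanishing_on:
  assumes "X \<subseteq> E" "subspace Y" "finite Y"
  shows "card {\<phi> \<in> linear_maps (col_span E) Y. \<forall>e\<in>X. \<phi> (col e) = 0} = card Y ^ (rk M E - rk M X)"
proof -
  have sub: "col_span X \<subseteq> col_span E"
    using assms(1) by (intro span_mono image_mono)
  have sp: "span (col_span X \<union> col ` E) = col_span E"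
    using sub by (auto simp: span_eq intro: span_base)
  obtain j where j: "card (col_span E) = CARD('f) ^ j * card (col_span X)"
    "card {\<phi> \<in> linear_maps (col_span E) Y. \<forall>v\<in>col_span X. \<phi> v = 0} = card Y ^ j"
    using card_linear_maps_vanishing[OF subspace_span finite_col_span[OF assms(1)], of "col ` E"]
      finite_ground assms(2,3) unfolding sp by blast
  have "CARD('f) ^ rk M E = CARD('f) ^ (j + rk M X)"
    using j(1) card_col_span[OF assms(1)] card_col_span[of E] by (simp add: power_add)
  then have "j = rk M E - rk M X"
    using one_less_card_field by simp
  moreover have "(\<forall>e\<in>X. \<phi> (col e) = 0) \<longleftrightarrow> (\<forall>v\<in>col_span X. \<phi> v = 0)"
    if \<phi>: "\<phi> \<in> linear_maps (col_span E) Y" for \<phi>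
  proof
    assume *: "\<forall>e\<in>X. \<phi> (col e) = 0"
    have "col_span X \<subseteq> {v \<in> col_span E. \<phi> v = 0}"
    proof (rule span_minimal)
      show "col ` X \<subseteq> {v \<in> col_span E. \<phi> v = 0}"
        using * assms(1) by (auto intro: span_base)
      show "subspace {v \<in> col_span E. \<phi> v = 0}"
        using linear_maps_add[OF \<phi>] linear_maps_scale[OF \<phi>] linear_maps_zero[OF \<phi>]
        by (intro subspaceI) (auto intro: span_zero span_add span_scale)
    qed
    then show "\<forall>v\<in>col_span X. \<phi> v = 0"
      by blast
  qed (auto intro: span_base)
  then have "{\<phi> \<in> linear_maps (col_span E) Y. \<forall>e\<in>X. \<phi> (col e) = 0} =
      {\<phi> \<in> linear_maps (col_span E) Y. \<forall>v\<in>col_span X. \<phi> v = 0}"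
    by blast
  ultimately show ?thesis
    using j(2) by simp
qed

text \<open>
  The critical theorem of Crapo and Rota. For \<open>card Y = q ^ m\<close> a map into \<open>Y\<close> is an \<open>m\<close>-tuple
  of linear functionals.
\<close>

lemma poly_characteristic_poly_card:
  assumes "loopless M" "subspace Y" "finite Y"
  shows "poly (characteristic_poly M) (card Y) =
    real (card {\<phi> \<in> linear_maps (col_span E) Y. \<forall>v\<in>col ` E. \<phi> v \<noteq> 0})"
proof -
  let ?H = "linear_maps (col_span E) Y"
  have fin: "finite ?H"
    by (simp add: finite_linear_maps assms finite_col_span)
  have "poly (characteristic_poly M) (card Y) =
      (\<Sum>X\<in>Pow E. (-1) ^ card X * real (card Y) ^ (rk M E - rk M X))"
    unfolding characteristic_poly_expansion[OF assms(1)] by (simp add: poly_sum poly_monom)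
  \<comment> \<open>Inclusion-exclusion: each power counts the maps that vanish on \<open>X\<close>.
    After exchanging the sums, a map contributes the alternating sum over the sets of elements that
    it kills, which is 1 if it kills none and 0 otherwise.\<close>
  also have "\<dots> = (\<Sum>X\<in>Pow E. (-1) ^ card X * (\<Sum>\<phi>\<in>?H. if \<forall>e\<in>X. \<phi> (col e) = 0 then 1 else 0))"
  proof (intro sum.cong refl arg_cong2[of _ _ _ _ "(*)"])
    fix X assume "X \<in> Pow E"
    then have "real (card Y) ^ (rk M E - rk M X) = real (card {\<phi> \<in> ?H. \<forall>e\<in>X. \<phi> (col e) = 0})"
      using card_linear_maps_vanishing_on[OF _ assms(2,3), of X] by simp
    also have "\<dots> = (\<Sum>\<phi>\<in>{\<phi> \<in> ?H. \<forall>e\<in>X. \<phi> (col e) = 0}. 1)"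
      by simp
    also have "\<dots> = (\<Sum>\<phi>\<in>?H. if \<forall>e\<in>X. \<phi> (col e) = 0 then 1 else 0)"
      using fin by (rule sum.inter_filter)
    finally show "real (card Y) ^ (rk M E - rk M X) =
      (\<Sum>\<phi>\<in>?H. if \<forall>e\<in>X. \<phi> (col e) = 0 then 1 else 0)" .
  qed
  also have "\<dots> = (\<Sum>X\<in>Pow E. \<Sum>\<phi>\<in>?H. if \<forall>e\<in>X. \<phi> (col e) = 0 then (-1) ^ card X else 0)"
    unfolding sum_distrib_left by (intro sum.cong) auto
  also have "\<dots> = (\<Sum>\<phi>\<in>?H. \<Sum>X\<in>Pow E. if \<forall>e\<in>X. \<phi> (col e) = 0 then (-1) ^ card X else 0)"
    by (rule sum.swap)
  also have "\<dots> = (\<Sum>\<phi>\<in>?H. if \<forall>v\<in>col ` E. \<phi> v \<noteq> 0 then 1 else 0)"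
  proof (intro sum.cong refl)
    fix \<phi>
    have "(\<Sum>X\<in>Pow E. if \<forall>e\<in>X. \<phi> (col e) = 0 then (-1) ^ card X else 0 :: real) =
        (\<Sum>X\<in>{X \<in> Pow E. \<forall>e\<in>X. \<phi> (col e) = 0}. (-1) ^ card X)"
      using finite_ground by (intro sum.inter_filter[symmetric]) simp
    also have "{X \<in> Pow E. \<forall>e\<in>X. \<phi> (col e) = 0} = Pow {e \<in> E. \<phi> (col e) = 0}"
      by auto
    also have "(\<Sum>X\<in>\<dots>. (-1) ^ card X :: real) = (if \<forall>v\<in>col ` E. \<phi> v \<noteq> 0 then 1 else 0)"
      using finite_ground by (subst sum_Pow_alternating) auto
    finally show "(\<Sum>X\<in>Pow E. if \<forall>e\<in>X. \<phi> (col e) = 0 then (-1) ^ card X else 0 :: real) =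
      (if \<forall>v\<in>col ` E. \<phi> v \<noteq> 0 then 1 else 0)" .
  qed
  also have "\<dots> = (\<Sum>\<phi>\<in>{\<phi> \<in> ?H. \<forall>v\<in>col ` E. \<phi> v \<noteq> 0}. 1)"
    using fin by (rule sum.inter_filter[symmetric])
  finally show ?thesis
    by simp
qed

text \<open>The counting polynomial and the characteristic polynomial agree at \<open>card Y\<close>
  for every finite subspace \<open>Y\<close>. In an infinite space the span of \<open>n\<close>
  vectors has at least \<open>n\<close> elements, so these sizes exceed all roots of a non-zero
  difference. With a loop, the characteristic polynomial is 0 by definition.\<close>

lemma chordal_characteristic_poly:
  assumes "chordal k (col_span E) N" "col ` E \<subseteq> N" "k > 0" and inf: "infinite (UNIV :: 'v set)"
  shows "zero_or_positive_above (real CARD('f) ^ (k - 1)) (characteristic_poly M)"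
proof (cases "loopless M")
  case True
  obtain P where P: "zero_or_positive_above (real CARD('f) ^ (k - 1)) P"
    "\<And>Y. subspace Y \<Longrightarrow> finite Y \<Longrightarrow>
      real (card {\<phi> \<in> linear_maps (col_span E) Y. \<forall>v\<in>col ` E. \<phi> v \<noteq> 0}) = poly P (card Y)"
    using chordal_avoiding_polynomial[OF assms(1,3,2)] by blast
  have "characteristic_poly M - P = 0"
  proof (rule ccontr)
    assume "characteristic_poly M - P \<noteq> 0"
    then have fin: "finite {x. poly (characteristic_poly M - P) x = 0}" (is "finite ?Z")
      by (rule poly_roots_finite)
    obtain b where b: "\<And>x. x \<in> ?Z \<Longrightarrow> x \<le> b"
      using bdd_above_finite[OF fin] unfolding bdd_above_def by blast
    obtain n :: nat where "b < real n"
      using reals_Archimedean2 by blast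
    with b have n: "\<And>x. x \<in> ?Z \<Longrightarrow> x < real n"
      by (meson le_less_trans)
    obtain B :: "'v set" where B: "finite B" "card B = n"
      using infinite_arbitrarily_large[OF inf] by blast
    then have "n \<le> card (span B)" and Y: "subspace (span B)" "finite (span B)"
      using card_mono[OF finite_span[OF B(1)] span_superset] by (auto simp: finite_span)
    moreover have "real (card (span B)) \<in> ?Z"
      using P(2)[OF Y] poly_characteristic_poly_card[OF True Y] by simp
    ultimately show False
      using n by fastforce
  qed
  with P(1) show ?thesis
    by simp
qed (simp add: characteristic_poly_def zero_or_positive_above_def)

end

section \<open>Components of a tree with a vertex deleted\<close>

lemma adjacent_sym: "(u, v) \<in> adjacent D \<Longrightarrow> (v, u) \<in> adjacent D"
  by (simp add: adjacent_def insert_commute)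

lemma reachable_in_refl: "u \<in> V \<Longrightarrow> (u, u) \<in> reachable_in V D"
  by (simp add: reachable_in_def)

lemma reachable_in_sym: "(u, v) \<in> reachable_in V D \<Longrightarrow> (v, u) \<in> reachable_in V D"
proof -
  have "sym (adjacent D \<inter> V \<times> V)"
    by (auto simp: sym_def adjacent_sym)
  then have "sym ((adjacent D \<inter> V \<times> V)\<^sup>*)"
    by (rule sym_rtrancl)
  then show "(u, v) \<in> reachable_in V D \<Longrightarrow> (v, u) \<in> reachable_in V D"
    by (auto simp: reachable_in_def dest: symD)
qed

lemma reachable_in_trans:
  "(u, v) \<in> reachable_in V D \<Longrightarrow> (v, w) \<in> reachable_in V D \<Longrightarrow> (u, w) \<in> reachable_in V D"
  by (auto simp: reachable_in_def)

lemma reachable_in_mono: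
  assumes "(u, v) \<in> reachable_in V D" "V \<subseteq> V'"
  shows "(u, v) \<in> reachable_in V' D"
  using assms rtrancl_mono[of "adjacent D \<inter> V \<times> V" "adjacent D \<inter> V' \<times> V'"]
  by (auto simp: reachable_in_def)

lemma reachable_in_edge: "{u, v} \<in> D \<Longrightarrow> u \<in> V \<Longrightarrow> v \<in> V \<Longrightarrow> (u, v) \<in> reachable_in V D"
  by (auto simp: reachable_in_def adjacent_def)

lemma equiv_reachable_in: "equiv V (reachable_in V D)"
proof (rule equivI)
  show "refl_on V (reachable_in V D)"
    by (auto intro!: refl_onI reachable_in_refl)
  show "reachable_in V D \<subseteq> V \<times> V"
    by (auto simp: reachable_in_def)
qed (auto intro: symI transI reachable_in_sym reachable_in_trans)

lemma components_disjoint: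
  "B \<in> components V D \<Longrightarrow> C \<in> components V D \<Longrightarrow> B \<noteq> C \<Longrightarrow> B \<inter> C = {}"
  unfolding components_def by (metis quotient_disj equiv_reachable_in)

lemma components_subset: "C \<in> components V D \<Longrightarrow> C \<subseteq> V"
  by (auto simp: components_def quotient_def reachable_in_def)

lemma finite_components: "finite V \<Longrightarrow> finite (components V D)"
  by (rule finite_subset[of _ "Pow V"]) (auto dest: components_subset)

lemma component_in_components: "u \<in> V \<Longrightarrow> reachable_in V D `` {u} \<in> components V D"
  unfolding components_def by (rule quotientI)

lemma components_reachable: "C \<in> components V D \<Longrightarrow> u \<in> C \<Longrightarrow> v \<in> C \<longleftrightarrow> (u, v) \<in> reachable_in V D"
  unfolding components_def
  by (auto simp: quotient_def intro: reachable_in_sym reachable_in_trans)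

text \<open>A walk through \<open>u\<close> would make \<open>u\<close> reachable from
  \<open>z\<close>.\<close>

lemma reachable_in_avoid:
  assumes "(z, w) \<in> reachable_in A D" "(z, u) \<notin> reachable_in A D"
  shows "(z, w) \<in> reachable_in (A - {u}) D"
proof -
  have z: "z \<in> A"
    using assms(1) by (simp add: reachable_in_def)
  have "(z, w) \<in> (adjacent D \<inter> A \<times> A)\<^sup>*"
    using assms(1) by (simp add: reachable_in_def)
  then have "(z, w) \<in> reachable_in A D \<and> (z, w) \<in> reachable_in (A - {u}) D"
  proof (induction rule: rtrancl_induct)
    case base
    have "z \<noteq> u"
      using assms(2) z by (auto simp: reachable_in_refl)
    then show ?case
      using z by (simp add: reachable_in_refl)
  next
    case (step y x)
    then have yx: "{y, x} \<in> D" "y \<in> A" "x \<in> A"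
      by (auto simp: adjacent_def)
    have zx: "(z, x) \<in> reachable_in A D"
      using reachable_in_trans[OF conjunct1[OF step.IH] reachable_in_edge[OF yx]] .
    with assms(2) step.IH have "y \<in> A - {u}" "x \<in> A - {u}"
      using yx by auto
    then have "(z, x) \<in> reachable_in (A - {u}) D"
      by (rule reachable_in_trans[OF conjunct2[OF step.IH] reachable_in_edge[OF yx(1)]])
    with zx show ?case
      by simp
  qed
  then show ?thesis
    by blast
qed

text \<open>\<open>w\<close> is the vertex just before the walk first meets
  \<open>v\<close>.\<close>

lemma reachable_in_first_hit:
  assumes "(z, v) \<in> reachable_in V D" "z \<noteq> v"
  obtains w where "(z, w) \<in> reachable_in (V - {v}) D" "{w, v} \<in> D"
proof -
  have "(z, v) \<in> (adjacent D \<inter> V \<times> V)\<^sup>*"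
    using assms(1) by (simp add: reachable_in_def)
  then have "z \<noteq> v \<longrightarrow> (\<exists>w. (z, w) \<in> reachable_in (V - {v}) D \<and> {w, v} \<in> D)"
  proof (induction rule: converse_rtrancl_induct)
    case (step z y)
    show ?case
    proof (cases "y = v")
      case True
      with step show ?thesis
        by (auto simp: adjacent_def intro: reachable_in_refl)
    next
      case False
      with step obtain w where w: "(y, w) \<in> reachable_in (V - {v}) D" "{w, v} \<in> D"
        by blast
      show ?thesis
      proof
        assume "z \<noteq> v"
        with step.hyps False have "(z, y) \<in> reachable_in (V - {v}) D"
          by (auto simp: adjacent_def intro: reachable_in_edge)
        with w show "\<exists>w. (z, w) \<in> reachable_in (V - {v}) D \<and> {w, v} \<in> D"
          using reachable_in_trans by fast
      qed
    qed
  qed simp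
  with assms(2) that show ?thesis
    by blast
qed

section \<open>Simple paths and cycles\<close>

text \<open>When the walk returns to a vertex, the path is cut back to the earlier visit.\<close>

lemma rtrancl_distinct_path:
  assumes "(a, b) \<in> r\<^sup>*"
  shows "\<exists>xs. xs \<noteq> [] \<and> hd xs = a \<and> last xs = b \<and> distinct xs \<and> successively (\<lambda>x y. (x, y) \<in> r) xs"
  using assms
proof (induction rule: rtrancl_induct)
  case base
  show ?case
    by (rule exI[of _ "[a]"]) simp
next
  case (step y z)
  then obtain xs where xs: "xs \<noteq> []" "hd xs = a" "last xs = y" "distinct xs"
    "successively (\<lambda>x y. (x, y) \<in> r) xs"
    by blast
  show ?case
  proof (cases "z \<in> set xs")
    case True
    then obtain ys zs where eq: "xs = (ys @ [z]) @ zs"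
      by (metis append.assoc append_Cons append_Nil split_list)
    then have "successively (\<lambda>x y. (x, y) \<in> r) (ys @ [z])"
      using xs(5) by (simp only: successively_append_iff)
    moreover have "hd (ys @ [z]) = a" "distinct (ys @ [z])"
      using xs(2,4) eq by (cases ys, auto)
    ultimately show ?thesis
      by (intro exI[of _ "ys @ [z]"]) simp
  next
    case False
    with xs step.hyps show ?thesis
      by (intro exI[of _ "xs @ [z]"]) (auto simp: successively_append_iff)
  qed
qed

text \<open>The deleted edge closes a simple path from \<open>p\<close> to \<open>v\<close>. The
  path has at least three vertices, since with two it would be the deleted edge itself.\<close>

lemma is_cycle_of_path_avoiding_edge:
  assumes "{p, v} \<in> D" "p \<noteq> v" "(p, v) \<in> (adjacent (D - {{p, v}}))\<^sup>*"
  shows "\<exists>xs. is_cycle D xs"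
proof -
  obtain xs where xs: "xs \<noteq> []" "hd xs = p" "last xs = v" "distinct xs"
    "successively (\<lambda>x y. (x, y) \<in> adjacent (D - {{p, v}})) xs"
    using rtrancl_distinct_path[OF assms(3)] by blast
  have "length xs \<noteq> 1"
    using xs(2,3) assms(2) by (auto simp: length_Suc_conv)
  moreover have "length xs \<noteq> 2"
    using xs(2,3,5) by (auto simp: numeral_2_eq_2 length_Suc_conv adjacent_def)
  moreover have "length xs \<noteq> 0"
    using xs(1) by simp
  ultimately have len: "3 \<le> length xs"
    by linarith
  have "{xs ! i, xs ! (Suc i mod length xs)} \<in> D" if "i < length xs" for i
  proof (cases "Suc i < length xs")
    case True
    with xs(5) show ?thesis
      by (auto simp: successively_conv_nth adjacent_def)
  next
    case False
    with that have i: "Suc i = length xs" "i = length xs - 1"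
      by auto
    then have "xs ! i = v" "xs ! (Suc i mod length xs) = p"
      using xs(1-3) by (auto simp: last_conv_nth hd_conv_nth)
    then show ?thesis
      using assms(1) by (simp add: insert_commute)
  qed
  with len xs(4) show ?thesis
    by (auto simp: is_cycle_def)
qed

section \<open>Branches at a vertex of a tree\<close>

lemma is_tree_reachable: "is_tree V D \<Longrightarrow> u \<in> V \<Longrightarrow> v \<in> V \<Longrightarrow> (u, v) \<in> reachable_in V D"
  by (simp add: is_tree_def)

text \<open>A walk from \<open>z\<close> stays in the branch of \<open>z\<close> until it first
  meets \<open>v\<close>; that branch is not \<open>C\<close>, so the walk misses \<open>u\<close>.
  Thus, seen from \<open>u\<close>, everything outside \<open>C\<close> lies in the branch that
  contains \<open>v\<close>.\<close>

lemma outside_component_reachable: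
  assumes "is_tree V D" "v \<in> V" "C \<in> components (V - {v}) D" "u \<in> C" "z \<in> V" "z \<notin> C"
  shows "(z, v) \<in> reachable_in (V - {u}) D"
proof (cases "z = v")
  case True
  have "u \<noteq> v"
    using components_subset assms(3,4) by blast
  with True assms(2) show ?thesis
    by (auto intro: reachable_in_refl)
next
  case False
  obtain w where w: "(z, w) \<in> reachable_in (V - {v}) D" "{w, v} \<in> D"
    using reachable_in_first_hit[OF is_tree_reachable[OF assms(1,5,2)] False] by blast
  have "(z, u) \<notin> reachable_in (V - {v}) D"
    using components_reachable[OF assms(3,4)] assms(6) reachable_in_sym by metis
  with w(1) have zw: "(z, w) \<in> reachable_in (V - {v} - {u}) D"
    by (rule reachable_in_avoid)
  then have "w \<in> V - {u}"
    by (auto simp: reachable_in_def)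
  moreover have "v \<in> V - {u}"
    using components_subset assms(2,3,4) by blast
  ultimately have "(w, v) \<in> reachable_in (V - {u}) D"
    using w(2) by (intro reachable_in_edge)
  moreover have "(z, w) \<in> reachable_in (V - {u}) D"
    using zw by (rule reachable_in_mono) auto
  ultimately show ?thesis
    by (rule reachable_in_trans[rotated])
qed

text \<open>A branch at \<open>p\<close> without \<open>v\<close> is joined to \<open>p\<close> by
  walks that miss \<open>v\<close>, so it lies in \<open>C\<close>. If the branch with
  \<open>v\<close> met \<open>C\<close> in \<open>z\<close>, a walk from \<open>p\<close> to
  \<open>z\<close> missing \<open>v\<close> and one from \<open>z\<close> to \<open>v\<close>
  missing \<open>p\<close> would join \<open>p\<close> and \<open>v\<close> without the edge
  \<open>{p, v}\<close>, and there would be a cycle.\<close>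

lemma component_subset_or_disjoint:
  assumes "is_tree V D" "{p, v} \<in> D" "p \<noteq> v" "C \<in> components (V - {v}) D" "p \<in> C"
    and B: "B \<in> components (V - {p}) D"
  shows "B \<subseteq> C \<or> B \<inter> C = {}"
proof (cases "v \<in> B")
  case False
  have "p \<in> V - {v}"
    using assms(4,5) components_subset by blast
  have "z \<in> C" if z: "z \<in> B" for z
  proof -
    have "z \<in> V" "z \<noteq> p"
      using z B components_subset by blast+
    then obtain w where w: "(z, w) \<in> reachable_in (V - {p}) D" "{w, p} \<in> D"
      using reachable_in_first_hit[OF is_tree_reachable[OF assms(1)]] \<open>p \<in> V - {v}\<close> by blast
    have "(z, v) \<notin> reachable_in (V - {p}) D"
      using components_reachable[OF B z] False by blast
    with w(1) have zw: "(z, w) \<in> reachable_in (V - {p} - {v}) D"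
      by (rule reachable_in_avoid)
    then have "w \<in> V - {v}"
      by (auto simp: reachable_in_def)
    with w(2) \<open>p \<in> V - {v}\<close> have "(w, p) \<in> reachable_in (V - {v}) D"
      by (intro reachable_in_edge)
    moreover have "(z, w) \<in> reachable_in (V - {v}) D"
      using zw by (rule reachable_in_mono) auto
    ultimately have "(p, z) \<in> reachable_in (V - {v}) D"
      by (rule reachable_in_sym[OF reachable_in_trans, rotated])
    then show ?thesis
      using components_reachable[OF assms(4,5)] by blast
  qed
  then show ?thesis
    by blast
next
  case True
  have False if z: "z \<in> B" "z \<in> C" for z
  proof -
    let ?r = "adjacent (D - {{p, v}})"
    \<comment> \<open>A walk that misses one end of the edge \<open>{p, v}\<close> cannot use
      it.\<close>
    have mono: "a \<in> ?r\<^sup>*" if "a \<in> (adjacent D \<inter> U \<times> U)\<^sup>*" "p \<notin> U \<or> v \<notin> U" for a U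
    proof -
      have "adjacent D \<inter> U \<times> U \<subseteq> ?r"
        using that(2) by (auto simp: adjacent_def doubleton_eq_iff)
      from rtrancl_mono[OF this] that(1) show ?thesis
        by (rule subsetD)
    qed
    have "(p, z) \<in> (adjacent D \<inter> (V - {v}) \<times> (V - {v}))\<^sup>*"
      using components_reachable[OF assms(4,5), of z] z(2) by (simp add: reachable_in_def)
    then have "(p, z) \<in> ?r\<^sup>*"
      by (rule mono) simp
    also have "(z, v) \<in> (adjacent D \<inter> (V - {p}) \<times> (V - {p}))\<^sup>*"
      using components_reachable[OF B z(1), of v] True by (simp add: reachable_in_def)
    then have "(z, v) \<in> ?r\<^sup>*"
      by (rule mono) simp
    finally (rtrancl_trans) have "(p, v) \<in> ?r\<^sup>*" .
    then show False
      using is_cycle_of_path_avoiding_edge[OF assms(2,3)] assms(1) by (auto simp: is_tree_def)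
  qed
  then show ?thesis
    by blast
qed

lemma reachable_in_crossing_edge:
  assumes "(a, b) \<in> reachable_in V D" "a \<in> X" "b \<notin> X"
  obtains p v where "p \<in> X" "v \<in> V - X" "{p, v} \<in> D"
proof -
  have "(a, b) \<in> (adjacent D \<inter> V \<times> V)\<^sup>*"
    using assms(1) by (simp add: reachable_in_def)
  then have "b \<notin> X \<longrightarrow> (\<exists>p\<in>X. \<exists>v\<in>V - X. {p, v} \<in> D)"
    by (induction rule: rtrancl_induct) (use assms(2) in \<open>auto simp: adjacent_def\<close>)
  with assms(3) that show ?thesis
    by blast
qed

section \<open>Tree-decompositions\<close>

context represented_matroid
begin

text \<open>The factor \<open>col_span E\<close> matters when \<open>V = {v}\<close>: the
  intersection over no branches is the whole ambient space.\<close>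

definition bag :: "nat set \<Rightarrow> nat set set \<Rightarrow> ('a \<Rightarrow> nat) \<Rightarrow> nat \<Rightarrow> 'v set" where
  "bag V D \<tau> v = col_span E \<inter>
    (\<Inter>C\<in>components (V - {v}) D. col_span (E - {e \<in> E. \<tau> e \<in> C}))"

lemma subspace_bag: "subspace (bag V D \<tau> v)"
  unfolding bag_def by (intro subspace_inter subspace_Int) auto

lemma bag_subset: "bag V D \<tau> v \<subseteq> col_span E"
  by (auto simp: bag_def)

lemma finite_bag: "finite (bag V D \<tau> v)"
  using bag_subset finite_col_span[of E] by (meson finite_subset order_refl)

text \<open>No branch at \<open>\<tau> e\<close> contains \<open>\<tau> e\<close>, so
  \<open>e\<close> is removed in none of the intersected spans.\<close>

lemma col_in_bag:
  assumes "e \<in> E"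
  shows "col e \<in> bag V D \<tau> (\<tau> e)"
  using assms components_subset by (fastforce simp: bag_def intro!: span_base)

text \<open>
  Branches are disjoint, so the intersection over the other branches contains \<open>col ` B\<^sub>j\<close>, and
  intersecting with \<open>span (E - B\<^sub>j)\<close> lowers the dimension by exactly the rank defect.
\<close>

lemma card_bag:
  assumes "finite V"
  shows "\<exists>w. node_width M V D \<tau> v = int w \<and> card (bag V D \<tau> v) = CARD('f) ^ w"
proof -
  let ?T = "\<lambda>C. col_span (E - {e \<in> E. \<tau> e \<in> C})"
  let ?K = "components (V - {v}) D"
  \<comment> \<open>Generalised to subfamilies of the branches, so that they are intersected one at
    a time.\<close>
  have "\<exists>w. int (rk M E) - (\<Sum>C\<in>\<C>. rank_defect M {e \<in> E. \<tau> e \<in> C}) = int w \<and>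
      card (col_span E \<inter> (\<Inter>C\<in>\<C>. ?T C)) = CARD('f) ^ w"
    if "finite \<C>" "\<C> \<subseteq> ?K" for \<C>
    using that
  proof (induction \<C> rule: finite_induct)
    case empty
    show ?case
      using card_col_span[of E] by (intro exI[of _ "rk M E"]) simp
  next
    case (insert C \<C>)
    let ?U = "col_span E \<inter> (\<Inter>C\<in>\<C>. ?T C)" and ?B = "{e \<in> E. \<tau> e \<in> C}"
    obtain w where w: "int (rk M E) - (\<Sum>C\<in>\<C>. rank_defect M {e \<in> E. \<tau> e \<in> C}) = int w"
      "card ?U = CARD('f) ^ w"
      using insert by blast
    have U: "subspace ?U" "finite ?U"
      using finite_col_span[of E] by (auto intro!: subspace_inter subspace_Int)
    have T: "subspace (?T C)" "finite (?T C)"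
      using finite_col_span[of "E - ?B"] by auto
    have B: "col ` ?B \<subseteq> ?U"
    proof clarify
      fix e assume e: "e \<in> E" "\<tau> e \<in> C"
      have "\<tau> e \<notin> C'" if "C' \<in> \<C>" for C'
        using components_disjoint[of C "V - {v}" D C'] insert that e(2) by blast
      then show "col e \<in> ?U"
        using e(1) by (auto intro: span_base)
    qed
    have "col ` E = col ` ?B \<union> col ` (E - ?B)"
      by auto
    also have "\<dots> \<subseteq> ?U \<union> ?T C"
      using B span_superset by (rule Un_mono)
    also have "\<dots> \<subseteq> span (?U \<union> ?T C)"
      by (rule span_superset)
    finally have "col ` E \<subseteq> span (?U \<union> ?T C)" .
    moreover have "?U \<union> ?T C \<subseteq> col_span E"
      using span_mono[of "col ` (E - ?B)" "col ` E"] by auto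
    ultimately have "span (?U \<union> ?T C) = col_span E"
      by (simp add: span_eq)
    then have "card (?U \<inter> ?T C) * CARD('f) ^ rk M E = CARD('f) ^ w * CARD('f) ^ rk M (E - ?B)"
      using card_Int_times_card_span_Un[OF U T] w(2) card_col_span[of E] card_col_span[of "E - ?B"]
      by simp
    moreover have le: "rk M (E - ?B) \<le> rk M E"
    proof -
      have "card (?T C) \<le> card (col_span E)"
        using finite_col_span[of E] by (intro card_mono span_mono) auto
      then show ?thesis
        using card_col_span[of E] card_col_span[of "E - ?B"] one_less_card_field by simp
    qed
    then obtain d where d: "rk M E = d + rk M (E - ?B)"
      by (metis le_add_diff_inverse2)
    ultimately have eq: "card (?U \<inter> ?T C) * CARD('f) ^ d = CARD('f) ^ w"
      using one_less_card_field by (simp add: power_add)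
    \<comment> \<open>A subspace contains 0. This yields \<open>d \<le> w\<close>, so the truncated
      difference \<open>w - d\<close> is the true one.\<close>
    have "1 \<le> card (?U \<inter> ?T C)"
      unfolding One_nat_def Suc_le_eq using card_subspace_pos[OF subspace_inter[OF U(1) T(1)]] U(2) by blast
    then have "CARD('f) ^ d \<le> CARD('f) ^ w"
      unfolding eq[symmetric] using mult_le_mono1 by fastforce
    then have "d \<le> w"
      using one_less_card_field by simp
    then have "CARD('f) ^ w = CARD('f) ^ (w - d) * CARD('f) ^ d"
      by (simp flip: power_add)
    then have "card (?U \<inter> ?T C) = CARD('f) ^ (w - d)"
      using eq one_less_card_field by simp
    moreover have "col_span E \<inter> (\<Inter>C\<in>insert C \<C>. ?T C) = ?U \<inter> ?T C"
      by auto
    moreover have "rank_defect M ?B = int d"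
      using d by (simp add: rank_defect_def)
    then have "int (rk M E) - (\<Sum>C\<in>insert C \<C>. rank_defect M {e \<in> E. \<tau> e \<in> C}) = int (w - d)"
      using insert.hyps w(1) \<open>d \<le> w\<close> by simp
    ultimately show ?case
      by (intro exI[of _ "w - d"]) (simp only: simp_thms)
  qed
  from this[OF finite_components[OF finite_Diff[OF assms]] order_refl] show ?thesis
    by (simp add: node_width_def bag_def)
qed

text \<open>The bag at \<open>v\<close> lies in the span of the elements placed outside
  \<open>C\<close>. The bag at a vertex \<open>u\<close> of \<open>C\<close> lies in the span of
  those placed inside \<open>C\<close>, because one branch at \<open>u\<close> contains everything
  outside \<open>C\<close>. Every branch at \<open>p\<close> is inside \<open>C\<close> or disjoint
  from it, so one of these two spans uses no element of that branch.\<close>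

lemma bag_Int_span_subset:
  assumes "tree_decomposition M V D \<tau>" "v \<in> V" "{p, v} \<in> D" "p \<noteq> v"
    and "C \<in> components (V - {v}) D" "p \<in> C" "X \<subseteq> C"
  shows "bag V D \<tau> v \<inter> span (\<Union>u\<in>X. bag V D \<tau> u) \<subseteq> bag V D \<tau> p"
proof
  have \<tau>: "\<tau> e \<in> V" if "e \<in> E" for e
    using assms(1) that by (auto simp: tree_decomposition_def)
  have tree: "is_tree V D"
    using assms(1) by (simp add: tree_decomposition_def)
  let ?el = "\<lambda>C. {e \<in> E. \<tau> e \<in> C}"
  fix x assume x: "x \<in> bag V D \<tau> v \<inter> span (\<Union>u\<in>X. bag V D \<tau> u)"
  have x1: "x \<in> col_span (E - ?el C)"
    using x assms(5) by (auto simp: bag_def)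
  have "bag V D \<tau> u \<subseteq> col_span (?el C)" if u: "u \<in> X" for u
  proof -
    let ?D = "reachable_in (V - {u}) D `` {v}"
    have uC: "u \<in> C"
      using u assms(7) by blast
    then have "v \<in> V - {u}"
      using assms(2,5) components_subset by blast
    then have "?D \<in> components (V - {u}) D"
      by (rule component_in_components)
    then have "bag V D \<tau> u \<subseteq> col_span (E - ?el ?D)"
      by (auto simp: bag_def)
    also have "E - ?el ?D \<subseteq> ?el C"
    proof
      fix e assume "e \<in> E - ?el ?D"
      then have e: "e \<in> E" "\<tau> e \<notin> ?D"
        by auto
      then show "e \<in> ?el C"
        using outside_component_reachable[OF tree assms(2,5) uC \<tau>[OF e(1)]] reachable_in_sym by fastforce
    qed
    then have "col_span (E - ?el ?D) \<subseteq> col_span (?el C)"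
      by (intro span_mono image_mono)
    finally show ?thesis .
  qed
  then have "span (\<Union>u\<in>X. bag V D \<tau> u) \<subseteq> col_span (?el C)"
    by (intro span_minimal) auto
  then have x2: "x \<in> col_span (?el C)"
    using x by blast
  have "x \<in> col_span (E - ?el B)" if B: "B \<in> components (V - {p}) D" for B
  proof -
    consider "B \<subseteq> C" | "B \<inter> C = {}"
      using component_subset_or_disjoint[OF tree assms(3,4,5,6) B] by blast
    then show ?thesis
    proof cases
      case 1
      then show ?thesis
        using x1 span_mono[of "col ` (E - ?el C)" "col ` (E - ?el B)"] by blast
    next
      case 2
      then show ?thesis
        using x2 span_mono[of "col ` ?el C" "col ` (E - ?el B)"] by blast
    qed
  qed
  moreover have "x \<in> col_span E"
    using x bag_subset by blast
  ultimately show "x \<in> bag V D \<tau> p"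
    by (auto simp: bag_def)
qed

section \<open>Assembling the bags along the tree\<close>

lemma chordal_of_tree_decomposition:
  assumes td: "tree_decomposition M V D \<tau>" and "width M V D \<tau> \<le> int k"
  shows "chordal k (col_span E) (\<Union>v\<in>V. bag V D \<tau> v)"
proof -
  let ?W = "bag V D \<tau>"
  have tree: "is_tree V D" and \<tau>: "\<tau> ` E \<subseteq> V"
    using td by (auto simp: tree_decomposition_def)
  then have V: "finite V" "V \<noteq> {}"
    by (auto simp: is_tree_def)
  have card_W: "card (?W v) \<le> CARD('f) ^ k" if "v \<in> V" for v
  proof -
    obtain w where w: "node_width M V D \<tau> v = int w" "card (?W v) = CARD('f) ^ w"
      using card_bag[OF V(1)] by blast
    have "node_width M V D \<tau> v \<le> width M V D \<tau>"
      unfolding width_def using V that by (intro Max_ge) auto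
    with w(1) assms(2) have "w \<le> k"
      by simp
    then show ?thesis
      unfolding w(2) using one_less_card_field by (intro power_increasing) auto
  qed
  \<comment> \<open>\<open>X\<close> is the set of vertices added so far. Its connectedness within
    itself puts it into a single branch at the next vertex \<open>v\<close>, the one that contains
    the neighbour \<open>p\<close>. Starting at \<open>Suc n\<close> keeps \<open>X\<close>
    non-empty, so that some edge leaves it.\<close>
  have "\<exists>X\<subseteq>V. card X = Suc n \<and> (\<forall>a\<in>X. \<forall>b\<in>X. (a, b) \<in> reachable_in X D) \<and>
      chordal k (span (\<Union>v\<in>X. ?W v)) (\<Union>v\<in>X. ?W v)" if "Suc n \<le> card V" for n
    using that
  proof (induction n)
    case 0
    obtain v where v: "v \<in> V"
      using V by blast
    have "chordal k (span ({0} \<union> ?W v)) ({0} \<union> ?W v)"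
      using v by (intro chordal_add_subspace chordal.zero subspace_bag finite_bag card_W) auto
    moreover have "{0} \<union> ?W v = ?W v"
      using subspace_0[OF subspace_bag] by auto
    ultimately show ?case
      using v by (intro exI[of _ "{v}"]) (auto intro: reachable_in_refl)
  next
    case (Suc n)
    then obtain X where X: "X \<subseteq> V" "card X = Suc n"
      and conn: "\<forall>a\<in>X. \<forall>b\<in>X. (a, b) \<in> reachable_in X D"
      and ch: "chordal k (span (\<Union>v\<in>X. ?W v)) (\<Union>v\<in>X. ?W v)"
      by auto
    have "X \<noteq> {}" "X \<noteq> V"
      using X Suc.prems by auto
    then obtain a b where "a \<in> X" "b \<in> V" "b \<notin> X"
      using X(1) by blast
    then obtain p v where pv: "p \<in> X" "v \<in> V - X" "{p, v} \<in> D"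
      using reachable_in_crossing_edge[OF is_tree_reachable[OF tree]] X(1) by blast
    then have neq: "p \<noteq> v" and pV: "p \<in> V - {v}" and XV: "X \<subseteq> V - {v}"
      using X(1) by auto
    let ?C = "reachable_in (V - {v}) D `` {p}"
    have "X \<subseteq> ?C"
      using conn pv(1) reachable_in_mono[OF _ XV] by auto
    moreover have "p \<in> ?C"
      using pV by (auto intro: reachable_in_refl)
    moreover have "?C \<in> components (V - {v}) D"
      using pV by (rule component_in_components)
    ultimately have "?W v \<inter> span (\<Union>u\<in>X. ?W u) \<subseteq> ?W p"
      using bag_Int_span_subset[OF td _ pv(3) neq] pv(2) by blast
    then have "?W v \<inter> span (\<Union>u\<in>X. ?W u) \<subseteq> (\<Union>u\<in>X. ?W u)"
      using pv(1) by blast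
    then have "chordal k (span (span (\<Union>v\<in>X. ?W v) \<union> ?W v)) ((\<Union>v\<in>X. ?W v) \<union> ?W v)"
      using pv(2) by (intro chordal_add_subspace ch subspace_bag finite_bag card_W) auto
    moreover have "span (span (\<Union>v\<in>X. ?W v) \<union> ?W v) = span (\<Union>u\<in>insert v X. ?W u)"
      unfolding span_eq by (auto intro: span_base span_mono[THEN subsetD, rotated])
    moreover have "(\<Union>v\<in>X. ?W v) \<union> ?W v = (\<Union>u\<in>insert v X. ?W u)"
      by auto
    moreover have "(a, b) \<in> reachable_in (insert v X) D" if "a \<in> insert v X" "b \<in> insert v X" for a b
    proof -
      have "(p, c) \<in> reachable_in (insert v X) D" if "c \<in> insert v X" for c
      proof (cases "c = v")
        case True
        then show ?thesis
          using pv by (intro reachable_in_edge) auto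
      next
        case False
        then have "(p, c) \<in> reachable_in X D"
          using conn pv(1) that by blast
        then show ?thesis
          by (rule reachable_in_mono) auto
      qed
      then show ?thesis
        using that by (meson reachable_in_sym reachable_in_trans)
    qed
    moreover have "card (insert v X) = Suc (Suc n)"
      using X pv(2) V(1) finite_subset[OF X(1)] by simp
    ultimately show ?case
      using X(1) pv(2) by (intro exI[of _ "insert v X"]) auto
  qed
  from this[of "card V - 1"] obtain X where X: "X \<subseteq> V" "card X = card V"
      "chordal k (span (\<Union>v\<in>X. ?W v)) (\<Union>v\<in>X. ?W v)"
    using V card_gt_0_iff[of V] by auto
  then have "X = V"
    using V(1) card_subset_eq by blast
  moreover have "span (\<Union>v\<in>V. ?W v) = col_span E"
  proof -
    have "col ` E \<subseteq> (\<Union>v\<in>V. ?W v)"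
      using col_in_bag \<tau> by fastforce
    then have "col ` E \<subseteq> span (\<Union>v\<in>V. ?W v)"
      using span_superset by (rule subset_trans)
    moreover have "(\<Union>v\<in>V. ?W v) \<subseteq> col_span E"
      by (intro UN_least bag_subset)
    ultimately show ?thesis
      by (simp only: span_eq)
  qed
  ultimately show ?thesis
    using X(3) by simp
qed

section \<open>Optimal decompositions\<close>

text \<open>The integers are not well-ordered, so the least width is taken over the natural numbers.
  All widths are natural because every node width is the dimension of a bag.\<close>

lemma tree_width_attained:
  obtains V D \<tau> where "tree_decomposition M V D \<tau>" "width M V D \<tau> = tree_width M"
proof -
  let ?P = "\<lambda>w. \<exists>V D \<tau>. tree_decomposition M V D \<tau> \<and> w = width M V D \<tau>"
  have "\<nexists>p. is_cycle {} p"
    by (auto simp: is_cycle_def intro!: exI[of _ 0])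
  \<comment> \<open>The tree with one vertex shows that some width exists.\<close>
  then have "tree_decomposition M {0} {} (\<lambda>_. 0)"
    by (auto simp: tree_decomposition_def is_tree_def intro: reachable_in_refl)
  then have ex: "?P (width M {0} {} (\<lambda>_. 0))"
    by blast
  have nonneg: "\<exists>n. w = int n" if "?P w" for w
  proof -
    obtain V D \<tau> where "tree_decomposition M V D \<tau>" and w: "w = width M V D \<tau>"
      using \<open>?P w\<close> by blast
    then have V: "finite V" "V \<noteq> {}"
      by (auto simp: tree_decomposition_def is_tree_def)
    then have "w \<in> node_width M V D \<tau> ` V"
      unfolding w width_def by (intro Max_in) auto
    then show ?thesis
      using card_bag[OF V(1)] by blast
  qed
  then obtain n where "?P (int n)"
    using ex by fastforce
  then have least: "?P (int (LEAST n. ?P (int n)))"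
    by (rule LeastI)
  have "tree_width M = int (LEAST n. ?P (int n))"
    unfolding tree_width_def
  proof (rule Least_equality)
    fix w assume w: "?P w"
    then obtain m where m: "w = int m"
      using nonneg by blast
    show "int (LEAST n. ?P (int n)) \<le> w"
      using w unfolding m of_nat_le_iff by (rule Least_le)
  qed (rule least)
  moreover obtain V D \<tau> where "tree_decomposition M V D \<tau>"
    "int (LEAST n. ?P (int n)) = width M V D \<tau>"
    using least by blast
  ultimately show ?thesis
    using that by simp
qed

lemma characteristic_poly_of_tree_width:
  assumes "tree_width M \<le> int k" "k > 0" "infinite (UNIV :: 'v set)"
  shows "zero_or_positive_above (real CARD('f) ^ (k - 1)) (characteristic_poly M)"
proof -
  obtain V D \<tau> where td: "tree_decomposition M V D \<tau>" and "width M V D \<tau> \<le> int k"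
    using tree_width_attained assms(1) by metis
  then have "chordal k (col_span E) (\<Union>v\<in>V. bag V D \<tau> v)"
    by (rule chordal_of_tree_decomposition)
  moreover have "col ` E \<subseteq> (\<Union>v\<in>V. bag V D \<tau> v)"
    using td col_in_bag by (fastforce simp: tree_decomposition_def)
  ultimately show ?thesis
    using assms(2,3) by (rule chordal_characteristic_poly)
qed

end

section \<open>Polynomials as the ambient vector space\<close>

lemma finite_field_space_smult:
  "finite_field_space (smult :: 'f::{finite,field} \<Rightarrow> 'f poly \<Rightarrow> 'f poly)"
  by unfold_locales (simp_all add: smult_add_right smult_add_left)

theorem theorem1p3:
  fixes M :: "'a pre_matroid" and q k :: nat
  assumes "primepow q" and "CARD('f::{finite,field}) = q" and "k > 0"
    and "matroid M" and "representable TYPE('f) M"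
    and "tree_width M \<le> int k"
  shows "characteristic_poly M = 0 \<or>
    (\<forall>x::real. x > real q ^ (k - 1) \<longrightarrow> poly (characteristic_poly M) x > 0)"
proof -
  \<comment> \<open>Columns become polynomials of degree below \<open>n\<close>: the ambient space must be infinite, in order to
    contain subspaces \<open>Y\<close> of unbounded size.\<close>
  obtain n and A :: "nat \<Rightarrow> 'a \<Rightarrow> 'f" where
    rep: "\<And>X. X \<subseteq> ground M \<Longrightarrow> X \<in> indeps M \<longleftrightarrow> columns_independent n A X"
    using assms(5) unfolding representable_def by blast
  define col where "col e = (\<Sum>i<n. monom (A i e) i)" for e
  have coeff_col: "coeff (col e) i = (if i < n then A i e else 0)" for e i
    by (simp add: col_def coeff_sum)
  have "(\<Sum>e\<in>X. smult (c e) (col e)) = 0 \<longleftrightarrow> (\<forall>i<n. (\<Sum>e\<in>X. c e * A i e) = 0)" for X c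
  proof -
    have "coeff (\<Sum>e\<in>X. smult (c e) (col e)) i = (if i < n then \<Sum>e\<in>X. c e * A i e else 0)" for i
      by (simp add: coeff_sum coeff_col)
    then show ?thesis
      by (auto simp: poly_eq_iff)
  qed
  then have "represented_matroid smult M col"
    using assms(4) finite_field_space_smult rep
    by (simp add: represented_matroid_def represented_matroid_axioms_def columns_independent_def)
  moreover have "infinite (UNIV :: 'f poly set)"
  proof -
    have "inj (\<lambda>n. monom (1 :: 'f) n)"
      by (auto simp: inj_def monom_eq_iff')
    then show ?thesis
      using finite_imageD infinite_UNIV_nat by (metis finite_subset subset_UNIV)
  qed
  ultimately have "zero_or_positive_above (real CARD('f) ^ (k - 1)) (characteristic_poly M)"
    using assms(3,6) represented_matroid.characteristic_poly_of_tree_width by blast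
  then show ?thesis
    using assms(2) by (simp add: zero_or_positive_above_def)
qed

end
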